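(* Let $0<\rho<1$, let $N\ge 2$ be even, and put $M=N/2$. Let $\mathbf{Q}^{(s)}_M$ and $\mathbf{Q}^{(a)}_M$ be the orthogonal matrices whose rows are the unit eigenvectors, ordered by increasing eigenvalue, of $$\mathbf{G}^{(s)}_M=\rho\,\Lambda^{\mathrm{II}}_M+(1-\rho)^2\mathbf{I}_M+\rho(1-\rho)\,q^{(s)}(q^{(s)})^T,\qquad \mathbf{G}^{(a)}_M=\rho\,\Lambda^{\mathrm{IV}}_M+(1-\rho)^2\mathbf{I}_M+\rho(1-\rho)\,q^{(a)}(q^{(a)})^T$$ respectively, where $q^{(s)}=\mathbf{C}^{\mathrm{II}}_M e_0$ and $q^{(a)}=\mathbf{C}^{\mathrm{IV}}_M e_0$. Then the Karhunen--Loève transform $\mathbf{W}_N(\rho)$ of the AR(1) covariance matrix factors exactly as $$\mathbf{W}_N(\rho)=\mathbf{P}_N\begin{pmatrix}\mathbf{Q}^{(s)}_M\mathbf{C}^{\mathrm{II}}_M & 0\\ 0 & \mathbf{Q}^{(a)}_M\mathbf{C}^{\mathrm{IV}}_M\end{pmatrix}\mathbf{B}_N ,$$ where equality is understood up to the signs of the rows (unit eigenvectors being determined only up to sign). That is, the rows of the right-hand side form an orthonormal system of eigenvectors of $\mathbf{R}_N(\rho)$, listed in order of decreasing eigenvalue of $\mathbf{R}_N(\rho)$.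
   Context: All indices start at $0$. $\mathbf{R}_N(\rho)=[\rho^{|i-j|}]_{i,j=0}^{N-1}$ is the AR(1) covariance matrix. Its Karhunen--Loève transform (KLT) $\mathbf{W}_N(\rho)$ is the orthogonal matrix whose rows are the unit eigenvectors of $\mathbf{R}_N(\rho)$, ordered by decreasing eigenvalue (the eigenvalues are distinct for $0<\rho<1$; each row is determined up to sign). For order $M$, $\mathbf{C}^{\mathrm{II}}_M$ and $\mathbf{C}^{\mathrm{IV}}_M$ are the orthonormal DCT-II and DCT-IV matrices, $[\mathbf{C}^{\mathrm{II}}_M]_{n,k}=\sqrt{2/M}\,\beta_n\cos\frac{\pi n(2k+1)}{2M}$ with $\beta_0=1/\sqrt2$, $\beta_n=1$ for $n\ge1$, and $[\mathbf{C}^{\mathrm{IV}}_M]_{n,k}=\sqrt{2/M}\cos\frac{\pi(2n+1)(2k+1)}{4M}$, $n,k=0,\dots,M-1$. $\Lambda^{\mathrm{II}}_M=\mathrm{diag}_{n=0,\dots,M-1}\big(2-2\cos\frac{n\pi}{M}\big)$ and $\Lambda^{\mathrm{IV}}_M=\mathrm{diag}_{n=0,\dots,M-1}\big(2-2\cos\frac{(2n+1)\pi}{2M}\big)$. $\mathbf{I}_M$ is the identity, $\mathbf{J}_M$ the order-reversal (counter-identity) matrix, and $e_0=(1,0,\dots,0)^T\in\mathbb{R}^M$. The butterfly is $\mathbf{B}_N=\frac{1}{\sqrt2}\begin{pmatrix}\mathbf{I}_M&\mathbf{J}_M\\ \mathbf{I}_M&-\mathbf{J}_M\end{pmatrix}$.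 $\mathbf{P}_N$ is the interleaving permutation matrix with $[\mathbf{P}_N]_{2i,\,i}=[\mathbf{P}_N]_{2i+1,\,M+i}=1$ for $i=0,\dots,M-1$ and all other entries zero. *)

theory Defs
  imports Complex_Main "Jordan_Normal_Form.Char_Poly"
begin

definition ar1_cov :: "nat \<Rightarrow> real \<Rightarrow> real mat" where
  "ar1_cov N \<rho> = mat N N (\<lambda>(i, j). \<rho> ^ nat \<bar>int i - int j\<bar>)"

text \<open>The library predicate \<open>orthogonal_mat\<close> only asks the columns to be nonzero and pairwise
  orthogonal, so orthogonality in the usual (orthonormal) sense is spelled out here.\<close>

definition orthonormal_eigenrows :: "real mat \<Rightarrow> real mat \<Rightarrow> (nat \<Rightarrow> real) \<Rightarrow> bool" where
  "orthonormal_eigenrows A Q ev \<longleftrightarrow>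
     A \<in> carrier_mat (dim_row A) (dim_row A) \<and>
     Q \<in> carrier_mat (dim_row A) (dim_row A) \<and>
     Q * transpose_mat Q = 1\<^sub>m (dim_row A) \<and>
     (\<forall>i < dim_row A. eigenvector A (row Q i) (ev i))"

text \<open>Both orders are weak and the matrices are given by predicates: that the spectrum is simple,
  and hence that the matrix is unique up to the signs of its rows, is not built in.\<close>

definition increasing_eigenrows :: "real mat \<Rightarrow> real mat \<Rightarrow> bool" where
  "increasing_eigenrows A Q \<longleftrightarrow>
     (\<exists>ev. orthonormal_eigenrows A Q ev \<and> (\<forall>i j. i \<le> j \<and> j < dim_row A \<longrightarrow> ev i \<le> ev j))"

definition decreasing_eigenrows :: "real mat \<Rightarrow> real mat \<Rightarrow> bool" where
  "decreasing_eigenrows A Q \<longleftrightarrow>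
     (\<exists>ev. orthonormal_eigenrows A Q ev \<and> (\<forall>i j. i \<le> j \<and> j < dim_row A \<longrightarrow> ev j \<le> ev i))"

definition is_klt :: "nat \<Rightarrow> real \<Rightarrow> real mat \<Rightarrow> bool" where
  "is_klt N \<rho> W \<longleftrightarrow> decreasing_eigenrows (ar1_cov N \<rho>) W"

definition eq_up_to_row_signs :: "real mat \<Rightarrow> real mat \<Rightarrow> bool" where
  "eq_up_to_row_signs A B \<longleftrightarrow>
     dim_row A = dim_row B \<and> dim_col A = dim_col B \<and>
     (\<forall>i < dim_row A. row A i = row B i \<or> row A i = - row B i)"

definition dct2 :: "nat \<Rightarrow> real mat" where
  "dct2 M = mat M M (\<lambda>(n, k). sqrt (2 / real M) * (if n = 0 then 1 / sqrt 2 else 1) *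
     cos (pi * real n * (2 * real k + 1) / (2 * real M)))"

definition dct4 :: "nat \<Rightarrow> real mat" where
  "dct4 M = mat M M (\<lambda>(n, k). sqrt (2 / real M) *
     cos (pi * (2 * real n + 1) * (2 * real k + 1) / (4 * real M)))"

definition Lambda2 :: "nat \<Rightarrow> real mat" where
  "Lambda2 M = mat_diag M (\<lambda>n. 2 - 2 * cos (real n * pi / real M))"

definition Lambda4 :: "nat \<Rightarrow> real mat" where
  "Lambda4 M = mat_diag M (\<lambda>n. 2 - 2 * cos ((2 * real n + 1) * pi / (2 * real M)))"

definition outer_product :: "real vec \<Rightarrow> real vec \<Rightarrow> real mat" where
  "outer_product u v = mat (dim_vec u) (dim_vec v) (\<lambda>(i, j). u $ i * v $ j)"

definition q_sym :: "nat \<Rightarrow> real vec" where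
  "q_sym M = dct2 M *\<^sub>v unit_vec M 0"

definition q_anti :: "nat \<Rightarrow> real vec" where
  "q_anti M = dct4 M *\<^sub>v unit_vec M 0"

definition G_sym :: "nat \<Rightarrow> real \<Rightarrow> real mat" where
  "G_sym M \<rho> = \<rho> \<cdot>\<^sub>m Lambda2 M + (1 - \<rho>)\<^sup>2 \<cdot>\<^sub>m 1\<^sub>m M
     + (\<rho> * (1 - \<rho>)) \<cdot>\<^sub>m outer_product (q_sym M) (q_sym M)"

definition G_anti :: "nat \<Rightarrow> real \<Rightarrow> real mat" where
  "G_anti M \<rho> = \<rho> \<cdot>\<^sub>m Lambda4 M + (1 - \<rho>)\<^sup>2 \<cdot>\<^sub>m 1\<^sub>m M
     + (\<rho> * (1 - \<rho>)) \<cdot>\<^sub>m outer_product (q_anti M) (q_anti M)"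

definition reversal_mat :: "nat \<Rightarrow> real mat" where
  "reversal_mat M = mat M M (\<lambda>(i, j). if i + j = M - 1 then 1 else 0)"

text \<open>The next two definitions are meant for even \<open>N\<close>.\<close>

definition butterfly :: "nat \<Rightarrow> real mat" where
  "butterfly N = (let M = N div 2 in
     (1 / sqrt 2) \<cdot>\<^sub>m
       four_block_mat (1\<^sub>m M) (reversal_mat M) (1\<^sub>m M) (- reversal_mat M))"

definition interleave_mat :: "nat \<Rightarrow> real mat" where
  "interleave_mat N = (let M = N div 2 in
     mat N N (\<lambda>(r, c).
       if \<exists>i<M. (r = 2 * i \<and> c = i) \<or> (r = 2 * i + 1 \<and> c = M + i) then 1 else 0))"

end

theory Submission
  imports Defs
begin

text \<open>Up to the factor \<open>1 - \<rho>\<^sup>2\<close> the inverse of the covariance matrix is a tridiagonal matrix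
  invariant under reversal of the index order. The butterfly splits it into two tridiagonal blocks of
  size \<open>M\<close>, which DCT-II and DCT-IV turn into \<open>G_sym\<close> and \<open>G_anti\<close>. The two blocks differ by a
  positive semidefinite matrix of rank one, so their eigenvalues interlace: this is why the
  interleaving permutation sorts the spectrum. A tridiagonal matrix with nonzero off-diagonal entries
  has a simple spectrum, so the order is strict and the eigenrows are unique up to sign.\<close>

text \<open>Each special term comes from one end of a chain. At index 0 the precision matrix has the
  diagonal entry \<open>1 + \<rho>\<^sup>2 - \<rho>\<^sup>2\<close>, whereas sampled cosines fit the
  entry \<open>1 + \<rho>\<^sup>2 - \<rho>\<close>. The mismatch
  \<open>\<rho> * (1 - \<rho>)\<close> sits in the single entry (0,0), and the cosine transforms
  turn it into the rank-one term built from \<open>q_sym\<close> or \<open>q_anti\<close>. At the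
  middle, the coupling \<open>- \<rho>\<close> between the two halves is folded with sign plus or
  minus onto the last diagonal entry of a block. This is the Neumann or the Dirichlet condition,
  which selects DCT-II or DCT-IV, and it makes the blocks differ by \<open>2 * \<rho>\<close> in one
  entry. The delicate point is the order. Rayleigh quotients give only weak interlacing, and
  \<open>Qs\<close> and \<open>Qa\<close> are only weakly ordered. Strictness is therefore
  established once, for the merged list of eigenvalues of the full precision matrix. Since these are
  positive, inversion turns their increasing order into the decreasing order required of the
  covariance matrix.\<close>

section \<open>Orthonormal eigenrows and Rayleigh quotients\<close>

text \<open>Trades a family of eigenvector conditions for one matrix equation, so that later steps
  are matrix algebra. Symmetry lets \<open>A\<close> act on rows from the right, and the rows are
  nonzero because they have norm one.\<close>

lemma orthonormal_eigenrows_iff: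
  assumes A: "A \<in> carrier_mat n n" and sym: "A\<^sup>T = A"
  shows "orthonormal_eigenrows A Q ev \<longleftrightarrow>
    Q \<in> carrier_mat n n \<and> Q * Q\<^sup>T = 1\<^sub>m n \<and> Q * A = mat_diag n ev * Q"
proof (cases "Q \<in> carrier_mat n n \<and> Q * Q\<^sup>T = 1\<^sub>m n")
  case True
  then have Q: "Q \<in> carrier_mat n n" and QQ: "Q * Q\<^sup>T = 1\<^sub>m n" by auto
  have sym': "A $$ (j, i) = A $$ (i, j)" if "i < n" "j < n" for i j
    using that A arg_cong[OF sym, of "\<lambda>B. B $$ (i, j)"] by simp
  have entry: "(A *\<^sub>v row Q i) $ j = (Q * A) $$ (i, j)" if "i < n" "j < n" for i j
    using that A Q by (simp add: scalar_prod_def) (rule sum.cong, auto simp: sym' mult.commute)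
  have diag: "(mat_diag n ev * Q) $$ (i, j) = ev i * Q $$ (i, j)" if "i < n" "j < n" for i j
    using that Q by (simp add: mat_diag_mult_left[OF Q])
  have nz: "row Q i \<noteq> 0\<^sub>v n" if "i < n" for i
  proof
    assume "row Q i = 0\<^sub>v n"
    moreover have "row Q i \<bullet> row Q i = 1"
      using that Q arg_cong[OF QQ, of "\<lambda>B. B $$ (i, i)"] by simp
    ultimately show False by simp
  qed
  have eig: "eigenvector A (row Q i) (ev i) \<longleftrightarrow>
      (\<forall>j<n. (Q * A) $$ (i, j) = (mat_diag n ev * Q) $$ (i, j))" if i: "i < n" for i
  proof -
    have "eigenvector A (row Q i) (ev i) \<longleftrightarrow> A *\<^sub>v row Q i = ev i \<cdot>\<^sub>v row Q i"
      using A Q nz[OF i] by (auto simp: eigenvector_def)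
    also have "\<dots> \<longleftrightarrow> (\<forall>j<n. (A *\<^sub>v row Q i) $ j = (ev i \<cdot>\<^sub>v row Q i) $ j)"
      using A Q by (metis (no_types, lifting) carrier_matD dim_mult_mat_vec eq_vecI index_row(2) index_smult_vec(2))
    also have "\<dots> \<longleftrightarrow> (\<forall>j<n. (Q * A) $$ (i, j) = (mat_diag n ev * Q) $$ (i, j))"
      using i Q entry[OF i] diag[OF i] by simp
    finally show ?thesis .
  qed
  have "Q * A = mat_diag n ev * Q \<longleftrightarrow>
      (\<forall>i<n. \<forall>j<n. (Q * A) $$ (i, j) = (mat_diag n ev * Q) $$ (i, j))"
    using A Q by (auto simp del: index_mult_mat(1) intro!: eq_matI simp: mat_diag_def)
  then show ?thesis
    using A Q QQ eig by (simp add: orthonormal_eigenrows_def)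
next
  case False
  then show ?thesis using A by (auto simp: orthonormal_eigenrows_def)
qed

lemma orthonormal_transpose_mult:
  assumes "(Q :: real mat) \<in> carrier_mat n n" "Q * Q\<^sup>T = 1\<^sub>m n"
  shows "Q\<^sup>T * Q = 1\<^sub>m n"
  using mat_mult_left_right_inverse[OF assms(1) _ assms(2)] assms(1) by simp

text \<open>Spectral expansion: in the coordinates \<open>y = Q *\<^sub>v x\<close> the quadratic
  form is diagonal, and the norm is preserved (Parseval).\<close>

lemma eigenrows_scalar_prod:
  assumes A: "A \<in> carrier_mat n n" and sym: "A\<^sup>T = A"
    and Q: "orthonormal_eigenrows A Q d" and x: "x \<in> carrier_vec n"
  shows "x \<bullet> x = (\<Sum>j<n. (row Q j \<bullet> x)\<^sup>2)"
    and "x \<bullet> (A *\<^sub>v x) = (\<Sum>j<n. d j * (row Q j \<bullet> x)\<^sup>2)"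
proof -
  have Qc: "Q \<in> carrier_mat n n" and QQ: "Q * Q\<^sup>T = 1\<^sub>m n" and QA: "Q * A = mat_diag n d * Q"
    using Q unfolding orthonormal_eigenrows_iff[OF A sym] by auto
  define y where "y = Q *\<^sub>v x"
  have y: "y \<in> carrier_vec n" using Qc x by (simp add: y_def)
  have yj: "y $ j = row Q j \<bullet> x" if "j < n" for j using that Qc by (simp add: y_def)
  have "Q\<^sup>T *\<^sub>v y = (Q\<^sup>T * Q) *\<^sub>v x"
    unfolding y_def using Qc x by (intro assoc_mult_mat_vec[symmetric]) auto
  then have xy: "Q\<^sup>T *\<^sub>v y = x"
    using x by (simp add: orthonormal_transpose_mult[OF Qc QQ])
  have move: "x \<bullet> z = y \<bullet> (Q *\<^sub>v z)" if "z \<in> carrier_vec n" for z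
    using transpose_vec_mult_scalar[OF Qc that y] xy by simp
  have "x \<bullet> x = y \<bullet> y" using move[OF x] by (simp add: y_def)
  then show "x \<bullet> x = (\<Sum>j<n. (row Q j \<bullet> x)\<^sup>2)"
    using y yj by (simp add: scalar_prod_def power2_eq_square lessThan_atLeast0)
  have "Q *\<^sub>v (A *\<^sub>v x) = (Q * A) *\<^sub>v x"
    using A Qc x by (intro assoc_mult_mat_vec[symmetric]) auto
  also have "\<dots> = mat_diag n d *\<^sub>v y"
    unfolding QA y_def using Qc x by (intro assoc_mult_mat_vec[OF mat_diag_dim]) auto
  finally have "x \<bullet> (A *\<^sub>v x) = y \<bullet> (mat_diag n d *\<^sub>v y)"
    using move[of "A *\<^sub>v x"] A x by simp
  moreover have "(mat_diag n d *\<^sub>v y) $ j = d j * y $ j" if "j < n" for j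
    using that y by (simp add: mat_diag_def scalar_prod_def if_distrib[of "\<lambda>t. t * _"] cong: if_cong)
  ultimately show "x \<bullet> (A *\<^sub>v x) = (\<Sum>j<n. d j * (row Q j \<bullet> x)\<^sup>2)"
    using y yj by (simp add: scalar_prod_def[of y] mat_diag_def power2_eq_square
        lessThan_atLeast0 ac_simps)
qed

text \<open>One half of the Courant-Fischer principle: only eigenvalues from \<open>d i\<close>
  upwards contribute to the expansion, weighted by squares.\<close>

lemma rayleigh_lower:
  assumes A: "A \<in> carrier_mat n n" and sym: "A\<^sup>T = A"
    and Q: "orthonormal_eigenrows A Q d" and x: "x \<in> carrier_vec n"
    and mono: "\<And>j k. j \<le> k \<Longrightarrow> k < n \<Longrightarrow> d j \<le> d k"
    and zero: "\<And>j. j < i \<Longrightarrow> row Q j \<bullet> x = 0"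
  shows "d i * (x \<bullet> x) \<le> x \<bullet> (A *\<^sub>v x)"
  unfolding eigenrows_scalar_prod[OF A sym Q x] sum_distrib_left
proof (rule sum_mono)
  fix j assume "j \<in> {..<n}"
  then show "d i * (row Q j \<bullet> x)\<^sup>2 \<le> d j * (row Q j \<bullet> x)\<^sup>2"
    using mono[of i j] zero[of j] by (cases "j < i") (auto intro: mult_right_mono)
qed

lemma rayleigh_upper:
  assumes A: "A \<in> carrier_mat n n" and sym: "A\<^sup>T = A"
    and Q: "orthonormal_eigenrows A Q d" and x: "x \<in> carrier_vec n"
    and mono: "\<And>j k. j \<le> k \<Longrightarrow> k < n \<Longrightarrow> d j \<le> d k" and i: "i < n"
    and zero: "\<And>j. i < j \<Longrightarrow> j < n \<Longrightarrow> row Q j \<bullet> x = 0"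
  shows "x \<bullet> (A *\<^sub>v x) \<le> d i * (x \<bullet> x)"
  unfolding eigenrows_scalar_prod[OF A sym Q x] sum_distrib_left
proof (rule sum_mono)
  fix j assume "j \<in> {..<n}"
  then show "d j * (row Q j \<bullet> x)\<^sup>2 \<le> d i * (row Q j \<bullet> x)\<^sup>2"
    using mono[of j i] i zero[of j] by (cases "i < j") (auto intro: mult_right_mono)
qed

section \<open>Interlacing under a rank-one perturbation\<close>

text \<open>There are \<open>n - 1\<close> linear conditions in dimension \<open>n\<close>. A zero
  row in the free slot \<open>k\<close> makes the system square and singular, so its determinant
  vanishes and the kernel is nontrivial.\<close>

lemma exists_orthogonal_vec:
  fixes r :: "nat \<Rightarrow> real vec"
  assumes r: "\<And>j. j < n \<Longrightarrow> j \<noteq> k \<Longrightarrow> r j \<in> carrier_vec n" and k: "k < n"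
  obtains x where "x \<in> carrier_vec n" "0 < x \<bullet> x" "\<And>j. j < n \<Longrightarrow> j \<noteq> k \<Longrightarrow> r j \<bullet> x = 0"
proof -
  define c where "c j = (if j = k then 0\<^sub>v n else r j)" for j
  have c: "c \<in> {0..<n} \<rightarrow> carrier_vec n" using r by (auto simp: c_def)
  let ?B = "mat\<^sub>r n n (\<lambda>i. if i = k then 0\<^sub>v n else c i)"
  obtain x where x: "x \<in> carrier_vec n" "x \<noteq> 0\<^sub>v n" "?B *\<^sub>v x = 0\<^sub>v n"
    using det_row_0[OF k c] det_0_iff_vec_prod_zero[of ?B n] by auto
  have "r j \<bullet> x = 0" if j: "j < n" "j \<noteq> k" for j
  proof -
    have "row ?B j = r j" using j r[of j] by (auto simp: c_def)
    then show ?thesis using arg_cong[OF x(3), of "\<lambda>v. v $ j"] j by simp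
  qed
  moreover have "0 < x \<bullet> x"
  proof -
    obtain i where "i < n" "x $ i \<noteq> 0" using x by (metis carrier_vecD eq_vecI index_zero_vec)
    then show ?thesis using x(1)
      by (auto simp: scalar_prod_def zero_less_mult_iff linorder_neq_iff intro!: sum_pos2[of _ i])
  qed
  ultimately show thesis using that x(1) by blast
qed

text \<open>Each inequality is tested on a vector that satisfies \<open>n - 1\<close> linear conditions, chosen so that
  both Rayleigh quotients are controlled.\<close>

lemma rank_one_interlacing:
  fixes A B :: "real mat"
  assumes A: "A \<in> carrier_mat n n" "A\<^sup>T = A" and B: "B \<in> carrier_mat n n" "B\<^sup>T = B"
    and U: "orthonormal_eigenrows A U a" and W: "orthonormal_eigenrows B W b"
    and a: "\<And>j k. j \<le> k \<Longrightarrow> k < n \<Longrightarrow> a j \<le> a k"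
    and b: "\<And>j k. j \<le> k \<Longrightarrow> k < n \<Longrightarrow> b j \<le> b k"
    and e: "e \<in> carrier_vec n" and c: "0 \<le> c"
    and AB: "\<And>x. x \<in> carrier_vec n \<Longrightarrow> x \<bullet> (B *\<^sub>v x) = x \<bullet> (A *\<^sub>v x) + c * (e \<bullet> x)\<^sup>2"
  shows "i < n \<Longrightarrow> a i \<le> b i" and "Suc i < n \<Longrightarrow> b i \<le> a (Suc i)"
proof -
  have rows: "row U j \<in> carrier_vec n" "row W j \<in> carrier_vec n" for j
    using U W A(1) B(1) unfolding orthonormal_eigenrows_def
    by (metis carrier_matD(1) row_carrier_vec carrier_matD(2) row_carrier)+
  show "a i \<le> b i" if i: "i < n"
  proof -
    \<comment> \<open>The first \<open>i\<close> conditions push the form of \<open>A\<close> above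
      \<open>a i\<close>; those after the free slot \<open>i\<close> push the form of
      \<open>B\<close> below \<open>b i\<close>.\<close>
    define r where "r j = (if j < i then row U j else row W j)" for j
    obtain x where x: "x \<in> carrier_vec n" "0 < x \<bullet> x"
      and r0: "\<And>j. j < n \<Longrightarrow> j \<noteq> i \<Longrightarrow> r j \<bullet> x = 0"
      using exists_orthogonal_vec[OF _ i, of r] rows unfolding r_def by metis
    have "a i * (x \<bullet> x) \<le> x \<bullet> (A *\<^sub>v x)"
    proof (rule rayleigh_lower[OF A U x(1) a])
      show "row U j \<bullet> x = 0" if "j < i" for j using r0[of j] that i by (simp add: r_def)
    qed
    also have "\<dots> \<le> x \<bullet> (B *\<^sub>v x)" using c by (simp add: AB[OF x(1)])
    also have "\<dots> \<le> b i * (x \<bullet> x)"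
    proof (rule rayleigh_upper[OF B W x(1) b i])
      show "row W j \<bullet> x = 0" if "i < j" "j < n" for j using r0[of j] that by (simp add: r_def)
    qed
    finally show ?thesis using x(2) by simp
  qed
  show "b i \<le> a (Suc i)" if i: "Suc i < n"
  proof -
    \<comment> \<open>One condition is spent on \<open>e\<close>: on vectors orthogonal to
      \<open>e\<close> the two forms coincide. The free slot moves to \<open>Suc i\<close>.\<close>
    define r where "r j = (if j < i then row W j else if j = i then e else row U j)" for j
    obtain x where x: "x \<in> carrier_vec n" "0 < x \<bullet> x"
      and r0: "\<And>j. j < n \<Longrightarrow> j \<noteq> Suc i \<Longrightarrow> r j \<bullet> x = 0"
      using exists_orthogonal_vec[OF _ i, of r] rows e unfolding r_def by metis
    have "b i * (x \<bullet> x) \<le> x \<bullet> (B *\<^sub>v x)"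
    proof (rule rayleigh_lower[OF B W x(1) b])
      show "row W j \<bullet> x = 0" if "j < i" for j using r0[of j] that i by (simp add: r_def)
    qed
    also have "\<dots> = x \<bullet> (A *\<^sub>v x)" using r0[of i] i by (simp add: AB[OF x(1)] r_def)
    also have "\<dots> \<le> a (Suc i) * (x \<bullet> x)"
    proof (rule rayleigh_upper[OF A U x(1) a i])
      show "row U j \<bullet> x = 0" if "Suc i < j" "j < n" for j using r0[of j] that by (simp add: r_def)
    qed
    finally show ?thesis using x(2) by simp
  qed
qed

section \<open>Uniqueness up to row signs\<close>

text \<open>The change of basis \<open>P = W * V\<^sup>T\<close> intertwines the two diagonal
  matrices, so a nonzero entry forces equal eigenvalues. As \<open>d\<close> is injective, the
  orthogonal matrix \<open>P\<close> is a signed permutation, and the two orders leave only the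
  identity permutation.\<close>

lemma eigenrows_unique_up_to_signs:
  fixes A :: "real mat"
  assumes A: "A \<in> carrier_mat n n" "A\<^sup>T = A"
    and V: "orthonormal_eigenrows A V d" and W: "orthonormal_eigenrows A W e"
    and d: "\<And>i j. i < j \<Longrightarrow> j < n \<Longrightarrow> d j < d i"
    and e: "\<And>i j. i \<le> j \<Longrightarrow> j < n \<Longrightarrow> e j \<le> e i"
  shows "eq_up_to_row_signs W V"
proof -
  note iff = orthonormal_eigenrows_iff[OF A]
  have V: "V \<in> carrier_mat n n" "V * V\<^sup>T = 1\<^sub>m n" "V * A = mat_diag n d * V"
    and W: "W \<in> carrier_mat n n" "W * W\<^sup>T = 1\<^sub>m n" "W * A = mat_diag n e * W"
    using V W unfolding iff by auto
  define P where "P = W * V\<^sup>T"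
  have P: "P \<in> carrier_mat n n" using V W by (simp add: P_def)
  have dt: "(mat_diag n d)\<^sup>T = mat_diag n d" by (rule eq_matI) (auto simp: mat_diag_def)
  have "mat_diag n e * P = (W * A) * V\<^sup>T"
    unfolding P_def W(3) using V W by (intro assoc_mult_mat[OF mat_diag_dim, symmetric]) auto
  also have "\<dots> = W * (A * V\<^sup>T)" using V W A by (intro assoc_mult_mat) auto
  also have "A * V\<^sup>T = (V * A)\<^sup>T" using transpose_mult[OF V(1) A(1)] A(2) by simp
  also have "\<dots> = V\<^sup>T * mat_diag n d" unfolding V(3) by (subst transpose_mult[OF mat_diag_dim V(1)]) (simp add: dt)
  also have "W * \<dots> = P * mat_diag n d"
    unfolding P_def using V W by (intro assoc_mult_mat[OF _ _ mat_diag_dim, symmetric]) auto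
  finally have comm: "mat_diag n e * P = P * mat_diag n d" .
  have ed: "e i = d j" if "i < n" "j < n" "P $$ (i, j) \<noteq> 0" for i j
    using arg_cong[OF comm, of "\<lambda>B. B $$ (i, j)"] that P
    by (simp add: mat_diag_mult_left[OF P] mat_diag_mult_right[OF P])
  have "P * V = W * (V\<^sup>T * V)" unfolding P_def using V W by (intro assoc_mult_mat) auto
  then have PV: "P * V = W" using W(1) by (simp add: orthonormal_transpose_mult[OF V(1,2)])
  have "P\<^sup>T = V * W\<^sup>T" unfolding P_def using transpose_mult[of W n n "V\<^sup>T" n] V W by simp
  then have "P * P\<^sup>T = (P * V) * W\<^sup>T" using P V W by (simp add: assoc_mult_mat[of _ n n _ n _ n])
  then have PP: "P * P\<^sup>T = 1\<^sub>m n" using PV W by simp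
  have PPij: "(\<Sum>k<n. P $$ (i, k) * P $$ (j, k)) = (if i = j then 1 else 0)" if "i < n" "j < n" for i j
    using arg_cong[OF PP, of "\<lambda>B. B $$ (i, j)"] that P by (simp add: scalar_prod_def lessThan_atLeast0)
  have "\<exists>j<n. P $$ (i, j) \<noteq> 0" if "i < n" for i
  proof (rule ccontr)
    assume "\<not> ?thesis"
    then have "(\<Sum>k<n. P $$ (i, k) * P $$ (i, k)) = 0" by (intro sum.neutral) auto
    then show False using PPij[OF that that] by simp
  qed
  \<comment> \<open>\<open>s i\<close> turns out to be the only column in which row \<open>i\<close>
    of \<open>P\<close> is nonzero.\<close>
  then obtain s where s: "\<And>i. i < n \<Longrightarrow> s i < n" "\<And>i. i < n \<Longrightarrow> P $$ (i, s i) \<noteq> 0" by metis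
  have dinj: "i = j" if "i < n" "j < n" "d i = d j" for i j
    using d[of i j] d[of j i] that by (cases i j rule: linorder_cases) auto
  have off: "P $$ (i, j) = 0" if "i < n" "j < n" "j \<noteq> s i" for i j
    using ed[of i j] ed[of i "s i"] s[of i] dinj[of j "s i"] that by metis
  have collapse: "(\<Sum>k<n. P $$ (i, k) * f k) = P $$ (i, s i) * f (s i)" if "i < n" for i and f :: "nat \<Rightarrow> real"
  proof -
    have "(\<Sum>k<n. P $$ (i, k) * f k) = (\<Sum>k<n. if k = s i then P $$ (i, s i) * f (s i) else 0)"
      using off[OF that] by (intro sum.cong) auto
    then show ?thesis using s(1)[OF that] by simp
  qed
  \<comment> \<open>Rows with a common nonzero column could not be orthogonal, which gives
    injectivity; the orders of \<open>d\<close> and \<open>e\<close> give weak monotonicity.\<close>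
  have smono: "s i < s j" if ij: "i < j" "j < n" for i j
  proof -
    have i: "i < n" using ij by simp
    have "s i \<noteq> s j"
      using PPij[OF i ij(2)] collapse[OF i, of "\<lambda>k. P $$ (j, k)"] s(2)[OF i] s(2)[OF ij(2)] ij by auto
    moreover have "s i \<le> s j"
      using d[of "s j" "s i"] e[of i j] ed[OF i s(1)[OF i] s(2)[OF i]]
        ed[OF ij(2) s(1)[OF ij(2)] s(2)[OF ij(2)]] s(1)[OF i] ij by (cases "s j < s i") auto
    ultimately show ?thesis by simp
  qed
  \<comment> \<open>A strictly increasing self-map of an initial segment is the identity: it is
    bounded below by induction from 0 and above by induction down from \<open>n - 1\<close>.\<close>
  have up: "i \<le> s i" if "i < n" for i
    using that
  proof (induction i)
    case (Suc i)
    then show ?case using smono[of i "Suc i"] by simp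
  qed simp
  have down: "s (n - Suc k) \<le> n - Suc k" if "k < n" for k
    using that
  proof (induction k)
    case 0
    then show ?case using s(1)[of "n - 1"] by simp
  next
    case (Suc k)
    have "s (n - Suc (Suc k)) < s (n - Suc k)" using Suc.prems by (intro smono) auto
    then show ?case using Suc by linarith
  qed
  have sid: "s i = i" if "i < n" for i
    using up[OF that] down[of "n - Suc i"] that by simp
  have "row W i = row V i \<or> row W i = - row V i" if i: "i < n" for i
  proof -
    have "P $$ (i, i) * P $$ (i, i) = 1"
      using PPij[OF i i] collapse[OF i, of "\<lambda>k. P $$ (i, k)"] sid[OF i] by simp
    then have "P $$ (i, i) = 1 \<or> P $$ (i, i) = - 1" by (metis square_eq_1_iff)
    moreover have "W $$ (i, j) = P $$ (i, i) * V $$ (i, j)" if "j < n" for j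
    proof -
      have "W $$ (i, j) = (\<Sum>k<n. P $$ (i, k) * V $$ (k, j))"
        unfolding PV[symmetric] using P V(1) i that by (simp add: scalar_prod_def lessThan_atLeast0)
      then show ?thesis using collapse[OF i, of "\<lambda>k. V $$ (k, j)"] sid[OF i] by simp
    qed
    ultimately show ?thesis using V(1) W(1) i by (auto intro!: eq_vecI)
  qed
  then show ?thesis using V(1) W(1) by (simp add: eq_up_to_row_signs_def)
qed

section \<open>Transport of eigenrows: conjugation, direct sums, permutations, inverses\<close>

text \<open>Serves both the cosine transforms and the butterfly: an orthogonal \<open>C\<close>
  intertwining \<open>T\<close> with \<open>K\<close> pulls eigenrows of \<open>K\<close> back to
  eigenrows of \<open>T\<close>, with the same eigenvalues.\<close>

lemma orthonormal_eigenrows_conj: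
  assumes K: "K \<in> carrier_mat n n" "K\<^sup>T = K" and T: "T \<in> carrier_mat n n" "T\<^sup>T = T"
    and Q: "orthonormal_eigenrows K Q d"
    and C: "C \<in> carrier_mat n n" "C * C\<^sup>T = 1\<^sub>m n" and CT: "C * T = K * C"
  shows "orthonormal_eigenrows T (Q * C) d"
proof -
  have Q: "Q \<in> carrier_mat n n" "Q * Q\<^sup>T = 1\<^sub>m n" "Q * K = mat_diag n d * Q"
    using Q unfolding orthonormal_eigenrows_iff[OF K] by auto
  have "C * (C\<^sup>T * Q\<^sup>T) = Q\<^sup>T"
    using Q C by (subst assoc_mult_mat[of _ n n _ n _ n, symmetric]) auto
  then have "(Q * C) * (Q * C)\<^sup>T = 1\<^sub>m n"
    using Q C by (simp add: transpose_mult[OF Q(1) C(1)] assoc_mult_mat[of _ n n _ n _ n])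
  moreover have "(Q * C) * T = (Q * K) * C"
    using Q(1) C(1) K(1) T(1) CT by (simp add: assoc_mult_mat[of _ n n _ n _ n])
  then have "(Q * C) * T = mat_diag n d * (Q * C)"
    unfolding Q(3) by (simp only: assoc_mult_mat[OF mat_diag_dim Q(1) C(1)])
  ultimately show ?thesis
    unfolding orthonormal_eigenrows_iff[OF T] using Q C by simp
qed

lemma four_block_diag_mult:
  fixes A :: "'a :: semiring_0 mat"
  assumes "A \<in> carrier_mat m m" "B \<in> carrier_mat n n" "C \<in> carrier_mat m m" "D \<in> carrier_mat n n"
  shows "four_block_mat A (0\<^sub>m m n) (0\<^sub>m n m) B * four_block_mat C (0\<^sub>m m n) (0\<^sub>m n m) D =
    four_block_mat (A * C) (0\<^sub>m m n) (0\<^sub>m n m) (B * D)"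
  using assms by (subst mult_four_block_mat[where ?nr1.0 = m and ?n1.0 = m and ?n2.0 = n
      and ?nr2.0 = n and ?nc1.0 = m and ?nc2.0 = n]) auto

lemma four_block_diag_transpose:
  assumes "A \<in> carrier_mat m m" "B \<in> carrier_mat n n"
  shows "(four_block_mat A (0\<^sub>m m n) (0\<^sub>m n m) B)\<^sup>T = four_block_mat A\<^sup>T (0\<^sub>m m n) (0\<^sub>m n m) B\<^sup>T"
  using assms by (subst transpose_four_block_mat[where ?nr1.0 = m and ?nc1.0 = m
      and ?nr2.0 = n and ?nc2.0 = n]) auto

text \<open>The eigenvalues are merely concatenated here; sorting them is left to the
  interleaving.\<close>

lemma orthonormal_eigenrows_four_block_diag:
  assumes K: "K \<in> carrier_mat m m" "K\<^sup>T = K" and L: "L \<in> carrier_mat n n" "L\<^sup>T = L"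
    and U: "orthonormal_eigenrows K U a" and V: "orthonormal_eigenrows L V b"
  shows "orthonormal_eigenrows (four_block_mat K (0\<^sub>m m n) (0\<^sub>m n m) L)
    (four_block_mat U (0\<^sub>m m n) (0\<^sub>m n m) V) (\<lambda>i. if i < m then a i else b (i - m))"
proof -
  let ?F = "\<lambda>A B. four_block_mat A (0\<^sub>m m n) (0\<^sub>m n m) B"
  have U: "U \<in> carrier_mat m m" "U * U\<^sup>T = 1\<^sub>m m" "U * K = mat_diag m a * U"
    using U unfolding orthonormal_eigenrows_iff[OF K] by auto
  have V: "V \<in> carrier_mat n n" "V * V\<^sup>T = 1\<^sub>m n" "V * L = mat_diag n b * V"
    using V unfolding orthonormal_eigenrows_iff[OF L] by auto
  have diag: "mat_diag (m + n) (\<lambda>i. if i < m then a i else b (i - m)) = ?F (mat_diag m a) (mat_diag n b)"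
    by (rule eq_matI) (auto simp: mat_diag_def)
  have F: "?F K L \<in> carrier_mat (m + n) (m + n)" using K L by simp
  have FT: "(?F K L)\<^sup>T = ?F K L" using K L by (simp add: four_block_diag_transpose)
  show ?thesis
    unfolding orthonormal_eigenrows_iff[OF F FT] diag
    using U V K L by (simp add: four_block_diag_transpose four_block_diag_mult[of _ m _ n])
qed

lemma orthonormal_eigenrows_permute:
  assumes A: "A \<in> carrier_mat n n" and Q: "orthonormal_eigenrows A Q d"
    and Y: "Y \<in> carrier_mat n n"
    and s: "\<And>i. i < n \<Longrightarrow> s i < n" "inj_on s {..<n}"
    and rows: "\<And>i. i < n \<Longrightarrow> row Y i = row Q (s i)"
  shows "orthonormal_eigenrows A Y (\<lambda>i. d (s i))"
proof -
  have Qc: "Q \<in> carrier_mat n n" and QQ: "Q * Q\<^sup>T = 1\<^sub>m n"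
    using Q A by (auto simp: orthonormal_eigenrows_def)
  have "row Q (s i) \<bullet> row Q (s j) = (if i = j then 1 else 0)" if "i < n" "j < n" for i j
    using arg_cong[OF QQ, of "\<lambda>B. B $$ (s i, s j)"] that s Qc by (auto dest: inj_onD)
  then have "Y * Y\<^sup>T = 1\<^sub>m n" using Y rows by (auto intro!: eq_matI)
  then show ?thesis using Q A Y s rows by (auto simp: orthonormal_eigenrows_def)
qed

text \<open>Multiplying \<open>V * T = mat_diag n d * V\<close> by \<open>R\<close> gives
  \<open>mat_diag n d * (V * R) = c \<cdot>\<^sub>m V\<close>, and the nonzero \<open>d i\<close>
  are divided out row by row.\<close>

lemma orthonormal_eigenrows_inverse:
  assumes T: "T \<in> carrier_mat n n" "T\<^sup>T = T" and R: "R \<in> carrier_mat n n" "R\<^sup>T = R"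
    and TR: "T * R = c \<cdot>\<^sub>m 1\<^sub>m n" and V: "orthonormal_eigenrows T V d"
    and d: "\<And>i. i < n \<Longrightarrow> d i \<noteq> 0"
  shows "orthonormal_eigenrows R V (\<lambda>i. c / d i)"
proof -
  have V: "V \<in> carrier_mat n n" "V * V\<^sup>T = 1\<^sub>m n" "V * T = mat_diag n d * V"
    using V unfolding orthonormal_eigenrows_iff[OF T] by auto
  have VR: "V * R \<in> carrier_mat n n" using V R by simp
  have "mat_diag n d * (V * R) = V * (T * R)"
    unfolding assoc_mult_mat[OF mat_diag_dim V(1) R(1), symmetric] V(3)[symmetric]
    using V T R by (intro assoc_mult_mat) auto
  then have eq: "mat_diag n d * (V * R) = c \<cdot>\<^sub>m V"
    using V(1) TR mult_smult_distrib[OF V(1) one_carrier_mat, of c] by simp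
  have "V * R = mat_diag n (\<lambda>i. c / d i) * V"
  proof (rule eq_matI)
    fix i j assume "i < dim_row (mat_diag n (\<lambda>i. c / d i) * V)" "j < dim_col (mat_diag n (\<lambda>i. c / d i) * V)"
    then have ij: "i < n" "j < n" using V by (auto simp: mat_diag_def)
    have "d i * (V * R) $$ (i, j) = c * V $$ (i, j)"
      using arg_cong[OF eq, of "\<lambda>B. B $$ (i, j)"] ij V
      by (simp add: mat_diag_mult_left[OF VR] del: index_mult_mat(1))
    then show "(V * R) $$ (i, j) = (mat_diag n (\<lambda>i. c / d i) * V) $$ (i, j)"
      using ij V d[OF ij(1)] by (simp add: mat_diag_mult_left[OF V(1)] field_simps del: index_mult_mat(1))
  qed (use V R in \<open>auto simp: mat_diag_def\<close>)
  then show ?thesis using V unfolding orthonormal_eigenrows_iff[OF R] by simp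
qed

section \<open>Tridiagonal matrices and simplicity of their spectrum\<close>

definition tridiag :: "nat \<Rightarrow> (nat \<Rightarrow> real) \<Rightarrow> real \<Rightarrow> real mat" where
  "tridiag n d c = mat n n (\<lambda>(i, j). if i = j then d i else if Suc i = j \<or> Suc j = i then c else 0)"

lemma tridiag_carrier[simp]: "tridiag n d c \<in> carrier_mat n n"
  by (simp add: tridiag_def)

lemma tridiag_transpose: "(tridiag n d c)\<^sup>T = tridiag n d c"
  by (rule eq_matI) (auto simp: tridiag_def)

lemma tridiag_row_sum:
  assumes i: "i < n"
  shows "(\<Sum>j<n. tridiag n d c $$ (i, j) * f j) =
    d i * f i + c * ((if i = 0 then 0 else f (i - 1)) + (if Suc i < n then f (Suc i) else 0))"
proof -
  \<comment> \<open>At \<open>i = 0\<close> truncated subtraction makes \<open>i - 1\<close>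
    coincide with \<open>i\<close>, hence the inner guard in the second summand.\<close>
  have "(\<Sum>j<n. tridiag n d c $$ (i, j) * f j) =
      (\<Sum>j<n. (if j = i then d i * f i else 0) + (if j = i - 1 then if i = 0 then 0 else c * f (i - 1) else 0)
        + (if j = Suc i then c * f (Suc i) else 0))"
    using i by (intro sum.cong) (auto simp: tridiag_def)
  also have "\<dots> = d i * f i + (if i = 0 then 0 else c * f (i - 1)) + (if Suc i < n then c * f (Suc i) else 0)"
    using i by (simp add: sum.distrib)
  finally show ?thesis by (simp add: algebra_simps)
qed

text \<open>Row \<open>k\<close> is a three-term recurrence that yields \<open>f (Suc k)\<close>
  from its two predecessors, because \<open>c\<close> can be divided out. An eigenvector is thus
  determined by its first coordinate.\<close>

lemma tridiag_recurrence_zero: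
  fixes f :: "nat \<Rightarrow> real"
  assumes c: "c \<noteq> 0" and f: "f 0 = 0"
    and rec: "\<And>i. i < n \<Longrightarrow> (\<Sum>j<n. tridiag n d c $$ (i, j) * f j) = m * f i"
  shows "i < n \<Longrightarrow> f i = 0"
proof (induction i rule: less_induct)
  case (less i)
  show ?case
  proof (cases i)
    case 0
    then show ?thesis using f by simp
  next
    case (Suc k)
    have "f k = 0" "f (k - 1) = 0" using less Suc by simp_all
    then show ?thesis using rec[of k] less.prems Suc c
      by (cases "k = 0") (simp_all add: tridiag_row_sum)
  qed
qed

lemma tridiag_eigenvalues_distinct:
  assumes c: "c \<noteq> 0" and V: "orthonormal_eigenrows (tridiag n d c) V e"
    and ij: "i < n" "j < n" "i \<noteq> j"
  shows "e i \<noteq> e j"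
proof
  assume e: "e i = e j"
  have Vc: "V \<in> carrier_mat n n" and VV: "V * V\<^sup>T = 1\<^sub>m n"
    and eig: "\<And>i. i < n \<Longrightarrow> tridiag n d c *\<^sub>v row V i = e i \<cdot>\<^sub>v row V i"
    using V by (auto simp: orthonormal_eigenrows_def eigenvector_def tridiag_def)
  have ip: "(\<Sum>k<n. V $$ (i, k) * V $$ (j, k)) = (if i = j then 1 else 0)" if "i < n" "j < n" for i j
    using arg_cong[OF VV, of "\<lambda>B. B $$ (i, j)"] that Vc by (simp add: scalar_prod_def lessThan_atLeast0)
  have rec: "(\<Sum>k<n. tridiag n d c $$ (l, k) * V $$ (i, k)) = e i * V $$ (i, l)" if "i < n" "l < n" for i l
  proof -
    have "(tridiag n d c *\<^sub>v row V i) $ l = (\<Sum>k<n. tridiag n d c $$ (l, k) * V $$ (i, k))"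
      using that Vc tridiag_carrier[of n d c]
      by (simp add: scalar_prod_def lessThan_atLeast0 del: tridiag_carrier)
    then show ?thesis using eig[OF that(1)] that Vc by simp
  qed
  \<comment> \<open>The combination of the two eigenrows is chosen to vanish at coordinate 0; a
    shared eigenvalue makes it satisfy the same recurrence.\<close>
  have "V $$ (j, 0) * V $$ (i, k) - V $$ (i, 0) * V $$ (j, k) = 0" if k: "k < n" for k
  proof (rule tridiag_recurrence_zero[OF c _ _ k, where d = d and m = "e i"])
    fix l assume l: "l < n"
    have "(\<Sum>k<n. tridiag n d c $$ (l, k) * (V $$ (j, 0) * V $$ (i, k) - V $$ (i, 0) * V $$ (j, k))) =
      V $$ (j, 0) * (\<Sum>k<n. tridiag n d c $$ (l, k) * V $$ (i, k)) -
      V $$ (i, 0) * (\<Sum>k<n. tridiag n d c $$ (l, k) * V $$ (j, k))"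
      by (simp add: sum_distrib_left sum_subtractf algebra_simps)
    then show "(\<Sum>k<n. tridiag n d c $$ (l, k) * (V $$ (j, 0) * V $$ (i, k) - V $$ (i, 0) * V $$ (j, k))) =
      e i * (V $$ (j, 0) * V $$ (i, l) - V $$ (i, 0) * V $$ (j, l))"
      using rec[OF ij(1) l] rec[OF ij(2) l] e by (simp add: algebra_simps)
  qed simp
  \<comment> \<open>Pairing with row \<open>i\<close> isolates \<open>V $$ (j, 0)\<close> by
    orthonormality. Once it is zero, the whole row \<open>j\<close> vanishes, against its norm
    one.\<close>
  then have "(\<Sum>k<n. V $$ (i, k) * (V $$ (j, 0) * V $$ (i, k) - V $$ (i, 0) * V $$ (j, k))) = 0"
    by simp
  moreover have "(\<Sum>k<n. V $$ (i, k) * (V $$ (j, 0) * V $$ (i, k) - V $$ (i, 0) * V $$ (j, k))) =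
      V $$ (j, 0) * (\<Sum>k<n. V $$ (i, k) * V $$ (i, k)) - V $$ (i, 0) * (\<Sum>k<n. V $$ (i, k) * V $$ (j, k))"
    by (simp add: sum_distrib_left sum_subtractf algebra_simps)
  ultimately have "V $$ (j, 0) = 0" using ip[OF ij(1,1)] ip[OF ij(1,2)] ij(3) by simp
  then have "V $$ (j, k) = 0" if "k < n" for k
    using tridiag_recurrence_zero[OF c _ rec[OF ij(2)] that] by simp
  then show False using ip[OF ij(2,2)] by simp
qed

section \<open>The precision matrix and its blocks\<close>

text \<open>The parameter \<open>b\<close> adjusts the last corner: \<open>\<rho>\<^sup>2\<close>
  gives the scaled precision matrix, \<open>\<rho>\<close> and \<open>- \<rho>\<close> the symmetric
  and antisymmetric blocks, 0 the bare half. The two corrections are separate summands, so they add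
  up in size one and \<open>M = 1\<close> is no special case.\<close>

definition ar1_tridiag :: "nat \<Rightarrow> real \<Rightarrow> real \<Rightarrow> real mat" where
  "ar1_tridiag n \<rho> b =
     tridiag n (\<lambda>i. 1 + \<rho>\<^sup>2 - (if i = 0 then \<rho>\<^sup>2 else 0) - (if Suc i = n then b else 0)) (- \<rho>)"

lemma ar1_tridiag_carrier[simp]: "ar1_tridiag n \<rho> b \<in> carrier_mat n n"
  by (simp add: ar1_tridiag_def)

lemma ar1_tridiag_dim[simp]: "dim_row (ar1_tridiag n \<rho> b) = n" "dim_col (ar1_tridiag n \<rho> b) = n"
  by (simp_all add: ar1_tridiag_def tridiag_def)

lemma ar1_tridiag_transpose: "(ar1_tridiag n \<rho> b)\<^sup>T = ar1_tridiag n \<rho> b"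
  by (simp add: ar1_tridiag_def tridiag_transpose)

lemma ar1_cov_carrier[simp]: "ar1_cov N \<rho> \<in> carrier_mat N N"
  by (simp add: ar1_cov_def)

lemma ar1_cov_transpose: "(ar1_cov N \<rho>)\<^sup>T = ar1_cov N \<rho>"
  by (rule eq_matI) (auto simp: ar1_cov_def abs_minus_commute)

text \<open>Away from the diagonal a column of the covariance matrix is geometric and solves the
  homogeneous recurrence, since \<open>1 + \<rho>\<^sup>2\<close> balances its two neighbours. The
  kink at the diagonal leaves \<open>1 - \<rho>\<^sup>2\<close>, and the corner corrections make up
  for the missing neighbours.\<close>

lemma ar1_tridiag_mult_cov:
  assumes N: "2 \<le> N"
  shows "ar1_tridiag N \<rho> (\<rho>\<^sup>2) * ar1_cov N \<rho> = (1 - \<rho>\<^sup>2) \<cdot>\<^sub>m 1\<^sub>m N"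
proof (rule eq_matI)
  fix i j assume "i < dim_row ((1 - \<rho>\<^sup>2) \<cdot>\<^sub>m 1\<^sub>m N)" "j < dim_col ((1 - \<rho>\<^sup>2) \<cdot>\<^sub>m 1\<^sub>m N)"
  then have ij: "i < N" "j < N" by auto
  have R: "ar1_cov N \<rho> $$ (k, j) = \<rho> ^ (if k \<le> j then j - k else k - j)" if "k < N" for k
    using ij that by (auto simp: ar1_cov_def intro!: arg_cong[of _ _ "\<lambda>m. \<rho> ^ m"])
  let ?g = "\<lambda>k. \<rho> ^ (if k \<le> j then j - k else k - j)"
  have "(ar1_tridiag N \<rho> (\<rho>\<^sup>2) * ar1_cov N \<rho>) $$ (i, j) = (\<Sum>k<N. ar1_tridiag N \<rho> (\<rho>\<^sup>2) $$ (i, k) * ?g k)"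
    using ij carrier_matD[OF ar1_cov_carrier[of N \<rho>]]
    by (simp add: scalar_prod_def lessThan_atLeast0 R)
  also have "\<dots> = (if i = j then 1 - \<rho>\<^sup>2 else 0)"
  proof -
    consider m where "j = i + Suc m" | "i = j" | m where "i = j + Suc m"
      by (metis less_imp_Suc_add linorder_cases add_Suc_right)
    then show ?thesis
    proof cases
      case 1
      then show ?thesis unfolding ar1_tridiag_def tridiag_row_sum[OF ij(1)] using ij
        by (cases i) (auto simp: algebra_simps power2_eq_square Suc_diff_le)
    next
      case 2
      then show ?thesis unfolding ar1_tridiag_def tridiag_row_sum[OF ij(1)] using ij N
        by (cases i) (auto simp: algebra_simps power2_eq_square)
    next
      case 3
      then show ?thesis unfolding ar1_tridiag_def tridiag_row_sum[OF ij(1)] using ij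
        by (auto simp: algebra_simps power2_eq_square)
    qed
  qed
  finally show "(ar1_tridiag N \<rho> (\<rho>\<^sup>2) * ar1_cov N \<rho>) $$ (i, j) = ((1 - \<rho>\<^sup>2) \<cdot>\<^sub>m 1\<^sub>m N) $$ (i, j)"
    using ij by simp
qed (use carrier_matD[OF ar1_cov_carrier[of N \<rho>]] in auto)

text \<open>Only the last diagonal entry changes. The parameters \<open>\<rho>\<close> and
  \<open>- \<rho>\<close> give the positive perturbation on which interlacing rests.\<close>

lemma ar1_tridiag_rank_one:
  assumes n: "0 < n" and x: "x \<in> carrier_vec n"
  shows "x \<bullet> (ar1_tridiag n \<rho> b *\<^sub>v x) =
    x \<bullet> (ar1_tridiag n \<rho> a *\<^sub>v x) + (a - b) * (unit_vec n (n - 1) \<bullet> x)\<^sup>2"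
proof -
  have form: "x \<bullet> (ar1_tridiag n \<rho> b *\<^sub>v x) = (\<Sum>i<n. x $ i * (\<Sum>j<n. ar1_tridiag n \<rho> b $$ (i, j) * x $ j))" for b
    using x by (simp add: scalar_prod_def lessThan_atLeast0)
  have "(\<Sum>j<n. ar1_tridiag n \<rho> b $$ (i, j) * x $ j) =
      (\<Sum>j<n. ar1_tridiag n \<rho> a $$ (i, j) * x $ j) + (if i = n - 1 then (a - b) * x $ (n - 1) else 0)"
    if i: "i < n" for i
    unfolding ar1_tridiag_def tridiag_row_sum[OF i] using i by (auto simp: algebra_simps)
  then have "x \<bullet> (ar1_tridiag n \<rho> b *\<^sub>v x) =
      (\<Sum>i<n. x $ i * (\<Sum>j<n. ar1_tridiag n \<rho> a $$ (i, j) * x $ j) +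
        (if i = n - 1 then (a - b) * (x $ (n - 1))\<^sup>2 else 0))"
    unfolding form by (intro sum.cong) (auto simp: distrib_left power2_eq_square)
  also have "\<dots> = x \<bullet> (ar1_tridiag n \<rho> a *\<^sub>v x) + (a - b) * (x $ (n - 1))\<^sup>2"
    unfolding form using n by (simp add: sum.distrib)
  finally show ?thesis using n x by simp
qed

section \<open>Cosine sums and orthonormality of the DCTs\<close>

text \<open>Telescoping: the factor \<open>2 * sin x\<close> turns each cosine into a difference of
  sines.\<close>

lemma sum_cos_odd_multiples:
  fixes x :: real
  shows "2 * sin x * (\<Sum>k<M. cos ((2 * real k + 1) * x)) = sin (2 * real M * x)"
proof (induction M)
  case (Suc M)
  have "sin (2 * real (Suc M) * x) - sin (2 * real M * x) = 2 * sin x * cos ((2 * real M + 1) * x)"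
  proof -
    have "2 * real (Suc M) * x = (2 * real M + 1) * x + x" "2 * real M * x = (2 * real M + 1) * x - x"
      by (simp_all add: algebra_simps)
    then show ?thesis by (simp only: sin_add sin_diff) simp
  qed
  then show ?case using Suc by (simp add: algebra_simps)
qed simp

text \<open>On this grid the telescoped sine is taken at a multiple of \<open>pi\<close>, hence
  vanishes; the bound on \<open>j\<close> keeps \<open>sin x\<close> away from zero unless
  \<open>j = 0\<close>.\<close>

lemma sum_cos_grid:
  assumes M: "0 < M" and j: "\<bar>j\<bar> < 2 * int M"
  shows "(\<Sum>k<M. cos ((2 * real k + 1) * (pi * real_of_int j / (2 * real M)))) = (if j = 0 then real M else 0)"
proof (cases "j = 0")
  case False
  let ?x = "pi * real_of_int j / (2 * real M)"
  have jr: "\<bar>real_of_int j\<bar> < 2 * real M" using j by linarith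
  have "sin ?x \<noteq> 0"
  proof
    assume "sin ?x = 0"
    then obtain m :: int where "?x = real_of_int m * pi" using sin_zero_iff_int2 by blast
    then have "real_of_int j = real_of_int (m * (2 * int M))" using M by (simp add: field_simps)
    then have "j = m * (2 * int M)" using of_int_eq_iff by blast
    then have "2 * int M dvd \<bar>j\<bar>" by simp
    then have "2 * int M \<le> \<bar>j\<bar>" using False by (intro zdvd_imp_le) simp_all
    then show False using j by simp
  qed
  moreover have "sin (2 * real M * ?x) = 0"
    using M sin_zero_iff_int2 by (simp add: mult.commute)
  ultimately show ?thesis using sum_cos_odd_multiples[of ?x M] False by simp
qed simp

text \<open>Covers both transforms: \<open>j\<close> and \<open>k\<close> are even for DCT-II and
  odd for DCT-IV, and equal parity makes half their sum and difference integers. For the frequencies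
  of the transforms, the term for \<open>j = - k\<close> counts only at \<open>j = k = 0\<close>; it
  doubles the norm there and accounts for the weight \<open>1 / sqrt 2\<close>.\<close>

lemma sum_cos_mult_grid:
  assumes M: "0 < M" and j: "\<bar>j + k\<bar> < 2 * 2 * int M" "\<bar>j - k\<bar> < 2 * 2 * int M" "even (j + k)"
  shows "(\<Sum>l<M. cos ((2 * real l + 1) * (pi * real_of_int j / (4 * real M))) *
      cos ((2 * real l + 1) * (pi * real_of_int k / (4 * real M)))) =
    (if j = k then real M / 2 else 0) + (if j = - k then real M / 2 else 0)"
proof -
  obtain p where p: "j + k = 2 * p" using j(3) by blast
  obtain q where q: "j - k = 2 * q" using j(3) by (metis even_add even_diff evenE)
  have jk: "real_of_int j = p + q" "real_of_int k = p - q" using p q by linarith+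
  have "(\<Sum>l<M. cos ((2 * real l + 1) * (pi * real_of_int j / (4 * real M))) *
      cos ((2 * real l + 1) * (pi * real_of_int k / (4 * real M)))) =
    (\<Sum>l<M. (cos ((2 * real l + 1) * (pi * real_of_int q / (2 * real M))) +
      cos ((2 * real l + 1) * (pi * real_of_int p / (2 * real M)))) / 2)"
  proof (rule sum.cong, rule refl)
    fix l
    show "cos ((2 * real l + 1) * (pi * real_of_int j / (4 * real M))) *
      cos ((2 * real l + 1) * (pi * real_of_int k / (4 * real M))) =
      (cos ((2 * real l + 1) * (pi * real_of_int q / (2 * real M))) +
      cos ((2 * real l + 1) * (pi * real_of_int p / (2 * real M)))) / 2"
      unfolding cos_times_cos jk using M
      by (intro arg_cong2[of _ _ _ _ "\<lambda>a b. (cos a + cos b) / 2"]) (simp_all add: field_simps)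
  qed
  also have "\<dots> = ((if q = 0 then real M else 0) + (if p = 0 then real M else 0)) / 2"
    using sum_cos_grid[OF M, of p] sum_cos_grid[OF M, of q] p q j
    by (simp add: sum.distrib flip: sum_divide_distrib)
  finally show ?thesis using p q by auto
qed

text \<open>The two transforms differ only in the weights \<open>w\<close> and the frequencies
  \<open>x\<close>. Both frequency grids are written below over the denominator
  \<open>4 * real M\<close>, so that one product formula serves both.\<close>

definition cos_mat :: "nat \<Rightarrow> (nat \<Rightarrow> real) \<Rightarrow> (nat \<Rightarrow> real) \<Rightarrow> real mat" where
  "cos_mat M w x = mat M M (\<lambda>(n, k). w n * cos ((2 * real k + 1) * x n))"

lemma cos_mat_carrier[simp]: "cos_mat M w x \<in> carrier_mat M M"
  by (simp add: cos_mat_def)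

lemma cos_mat_dim[simp]: "dim_row (cos_mat M w x) = M" "dim_col (cos_mat M w x) = M"
  by (simp_all add: cos_mat_def)

lemma dct2_eq_cos_mat:
  "dct2 M = cos_mat M (\<lambda>n. sqrt (2 / real M) * (if n = 0 then 1 / sqrt 2 else 1))
     (\<lambda>n. pi * real_of_int (2 * int n) / (4 * real M))"
  unfolding dct2_def cos_mat_def
  by (rule arg_cong[of _ _ "mat M M"]) (auto intro!: ext arg_cong[of _ _ cos] simp: field_simps)

lemma dct4_eq_cos_mat:
  "dct4 M = cos_mat M (\<lambda>n. sqrt (2 / real M)) (\<lambda>n. pi * real_of_int (2 * int n + 1) / (4 * real M))"
  unfolding dct4_def cos_mat_def
  by (rule arg_cong[of _ _ "mat M M"]) (auto intro!: ext arg_cong[of _ _ cos] simp: field_simps)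

lemma cos_mat_mult_transpose:
  assumes "n < M" "m < M"
  shows "(cos_mat M w x * (cos_mat M w x)\<^sup>T) $$ (n, m) =
    w n * w m * (\<Sum>k<M. cos ((2 * real k + 1) * x n) * cos ((2 * real k + 1) * x m))"
  using assms by (simp add: cos_mat_def scalar_prod_def lessThan_atLeast0 sum_distrib_left ac_simps)

lemma dct2_orthonormal:
  assumes M: "0 < M"
  shows "dct2 M * (dct2 M)\<^sup>T = 1\<^sub>m M"
proof (rule eq_matI)
  fix n m assume "n < dim_row (1\<^sub>m M :: real mat)" "m < dim_col (1\<^sub>m M :: real mat)"
  then have nm: "n < M" "m < M" by auto
  show "(dct2 M * (dct2 M)\<^sup>T) $$ (n, m) = 1\<^sub>m M $$ (n, m)"
    unfolding dct2_eq_cos_mat cos_mat_mult_transpose[OF nm]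
    using sum_cos_mult_grid[OF M, of "2 * int n" "2 * int m"] nm M
    by (simp add: field_simps)
qed (simp_all add: dct2_def)

lemma dct4_orthonormal:
  assumes M: "0 < M"
  shows "dct4 M * (dct4 M)\<^sup>T = 1\<^sub>m M"
proof (rule eq_matI)
  fix n m assume "n < dim_row (1\<^sub>m M :: real mat)" "m < dim_col (1\<^sub>m M :: real mat)"
  then have nm: "n < M" "m < M" by auto
  show "(dct4 M * (dct4 M)\<^sup>T) $$ (n, m) = 1\<^sub>m M $$ (n, m)"
    unfolding dct4_eq_cos_mat cos_mat_mult_transpose[OF nm]
    using sum_cos_mult_grid[OF M, of "2 * int n + 1" "2 * int m + 1"] nm M
    by (simp add: field_simps)
qed (simp_all add: dct4_def)

section \<open>Cosine transforms of the tridiagonal blocks\<close>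

text \<open>Common shape of \<open>G_sym\<close> and \<open>G_anti\<close>. For
  \<open>l i = 2 - 2 * cos t\<close> the diagonal part equals
  \<open>1 + \<rho>\<^sup>2 - 2 * \<rho> * cos t\<close>, the symbol of the tridiagonal
  matrix.\<close>

definition diag_plus_rank_one :: "nat \<Rightarrow> real \<Rightarrow> (nat \<Rightarrow> real) \<Rightarrow> real vec \<Rightarrow> real mat" where
  "diag_plus_rank_one M \<rho> l q = \<rho> \<cdot>\<^sub>m mat_diag M l + (1 - \<rho>)\<^sup>2 \<cdot>\<^sub>m 1\<^sub>m M
     + (\<rho> * (1 - \<rho>)) \<cdot>\<^sub>m outer_product q q"

lemma diag_plus_rank_one_carrier:
  "q \<in> carrier_vec M \<Longrightarrow> diag_plus_rank_one M \<rho> l q \<in> carrier_mat M M"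
  by (simp add: diag_plus_rank_one_def outer_product_def)

lemma diag_plus_rank_one_index:
  assumes "q \<in> carrier_vec M" "i < M" "j < M"
  shows "diag_plus_rank_one M \<rho> l q $$ (i, j) =
    (if i = j then \<rho> * l i + (1 - \<rho>)\<^sup>2 else 0) + \<rho> * (1 - \<rho>) * q $ i * q $ j"
  using assms by (simp add: diag_plus_rank_one_def outer_product_def mat_diag_def)

lemma diag_plus_rank_one_transpose:
  assumes q: "q \<in> carrier_vec M"
  shows "(diag_plus_rank_one M \<rho> l q)\<^sup>T = diag_plus_rank_one M \<rho> l q"
  using carrier_matD[OF diag_plus_rank_one_carrier[OF q, of \<rho> l]]
  by (intro eq_matI) (auto simp: diag_plus_rank_one_index[OF q])

lemma diag_plus_rank_one_row_sum:
  assumes q: "q \<in> carrier_vec M" and i: "i < M"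
  shows "(\<Sum>j<M. diag_plus_rank_one M \<rho> l q $$ (i, j) * f j) =
    (\<rho> * l i + (1 - \<rho>)\<^sup>2) * f i + \<rho> * (1 - \<rho>) * q $ i * (\<Sum>j<M. q $ j * f j)"
proof -
  have "(\<Sum>j<M. diag_plus_rank_one M \<rho> l q $$ (i, j) * f j) =
    (\<Sum>j<M. (if j = i then (\<rho> * l i + (1 - \<rho>)\<^sup>2) * f i else 0) + \<rho> * (1 - \<rho>) * q $ i * (q $ j * f j))"
    using i by (intro sum.cong) (auto simp: diag_plus_rank_one_index[OF q i] algebra_simps)
  then show ?thesis using i by (simp add: sum.distrib sum_distrib_left)
qed

text \<open>The quadratic form at a unit eigenrow is at least \<open>(1 - \<rho>)\<^sup>2\<close>,
  as its other two terms are nonnegative. Positivity is what lets inversion reverse the order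
  later.\<close>

lemma diag_plus_rank_one_eigenvalues_pos:
  assumes \<rho>: "0 < \<rho>" "\<rho> < 1" and q: "q \<in> carrier_vec M" and l: "\<And>i. i < M \<Longrightarrow> 0 \<le> l i"
    and Q: "orthonormal_eigenrows (diag_plus_rank_one M \<rho> l q) Q d" and i: "i < M"
  shows "0 < d i"
proof -
  let ?G = "diag_plus_rank_one M \<rho> l q"
  note G = diag_plus_rank_one_carrier[OF q, of \<rho> l]
  define u where "u = row Q i"
  have u: "u \<in> carrier_vec M" "?G *\<^sub>v u = d i \<cdot>\<^sub>v u"
    and Qc: "Q \<in> carrier_mat M M" and QQ: "Q * Q\<^sup>T = 1\<^sub>m M"
    using Q i G by (auto simp: u_def orthonormal_eigenrows_def eigenvector_def)
  have "row Q i \<bullet> row Q i = 1"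
    using arg_cong[OF QQ, of "\<lambda>B. B $$ (i, i)"] Qc i by simp
  then have uu: "(\<Sum>k<M. u $ k * u $ k) = 1" using Qc by (simp add: u_def scalar_prod_def lessThan_atLeast0)
  have "(?G *\<^sub>v u) $ k = (\<Sum>j<M. ?G $$ (k, j) * u $ j)" if "k < M" for k
    using that u(1) G by (simp add: scalar_prod_def lessThan_atLeast0)
  then have eig: "d i * u $ k = (\<rho> * l k + (1 - \<rho>)\<^sup>2) * u $ k + \<rho> * (1 - \<rho>) * q $ k * (\<Sum>j<M. q $ j * u $ j)"
    if "k < M" for k
    using that u by (simp add: diag_plus_rank_one_row_sum[OF q that])
  have "d i = (\<Sum>k<M. u $ k * (d i * u $ k))"
    using uu by (simp add: sum_distrib_left[symmetric] mult.left_commute)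
  also have "\<dots> = (\<Sum>k<M. (\<rho> * l k + (1 - \<rho>)\<^sup>2) * (u $ k * u $ k) +
      \<rho> * (1 - \<rho>) * (\<Sum>j<M. q $ j * u $ j) * (q $ k * u $ k))"
    by (rule sum.cong) (auto simp: eig algebra_simps)
  also have "\<dots> = (\<Sum>k<M. (\<rho> * l k + (1 - \<rho>)\<^sup>2) * (u $ k * u $ k)) +
      \<rho> * (1 - \<rho>) * (\<Sum>j<M. q $ j * u $ j)\<^sup>2"
    by (simp add: sum.distrib sum_distrib_left[symmetric] power2_eq_square)
  also have "\<dots> \<ge> (\<Sum>k<M. (1 - \<rho>)\<^sup>2 * (u $ k * u $ k))"
    using \<rho> l by (intro add_increasing2[OF _ sum_mono[OF mult_right_mono]]) auto
  finally have "(1 - \<rho>)\<^sup>2 \<le> d i" by (simp add: sum_distrib_left[symmetric] uu)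
  moreover have "0 < (1 - \<rho>)\<^sup>2" using \<rho> by simp
  ultimately show ?thesis by linarith
qed

text \<open>The hypothesis \<open>bdry\<close> says that the cosines, continued to \<open>k = M\<close>, satisfy the
  Neumann (\<open>s = 1\<close>) or Dirichlet (\<open>s = - 1\<close>) boundary condition at \<open>M - 1/2\<close>; the Neumann
  condition at \<open>- 1/2\<close> holds automatically.\<close>

lemma cos_mat_mult_ar1_tridiag:
  assumes M: "0 < M" and orth: "cos_mat M w x * (cos_mat M w x)\<^sup>T = 1\<^sub>m M"
    and bdry: "\<And>n. n < M \<Longrightarrow> cos ((2 * real M + 1) * x n) = s * cos ((2 * real M - 1) * x n)"
  shows "cos_mat M w x * ar1_tridiag M \<rho> (s * \<rho>) =
    diag_plus_rank_one M \<rho> (\<lambda>n. 2 - 2 * cos (2 * x n)) (cos_mat M w x *\<^sub>v unit_vec M 0) * cos_mat M w x"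
proof -
  let ?C = "cos_mat M w x" and ?K = "ar1_tridiag M \<rho> (s * \<rho>)"
  let ?q = "?C *\<^sub>v unit_vec M 0" and ?l = "\<lambda>n. 2 - 2 * cos (2 * x n)"
  let ?G = "diag_plus_rank_one M \<rho> ?l ?q"
  have C: "?C \<in> carrier_mat M M" by simp
  have q: "?q \<in> carrier_vec M" by (simp add: mult_mat_vec_carrier[OF C])
  note G = diag_plus_rank_one_carrier[OF q, of \<rho> ?l]
  have qn: "?q $ n = ?C $$ (n, 0)" if "n < M" for n
    using that M C by simp
  have CTC: "?C\<^sup>T * ?C = 1\<^sub>m M" by (rule orthonormal_transpose_mult[OF C orth])
  \<comment> \<open>\<open>?q\<close> is column 0 of \<open>?C\<close>, and the columns are
    orthonormal; the rank-one term times \<open>?C\<close> therefore lives in column 0.\<close>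
  have col: "(\<Sum>m<M. ?q $ m * ?C $$ (m, k)) = (if k = 0 then 1 else 0)" if k: "k < M" for k
    using arg_cong[OF CTC, of "\<lambda>B. B $$ (0, k)"] k M C
    by (simp add: scalar_prod_def lessThan_atLeast0 qn del: index_mult_mat_vec)
  have step: "cos ((2 * real k + 3) * t) + cos ((2 * real k - 1) * t) = 2 * cos (2 * t) * cos ((2 * real k + 1) * t)"
    for k t
  proof -
    have "(2 * real k + 3) * t = (2 * real k + 1) * t + 2 * t" "(2 * real k - 1) * t = (2 * real k + 1) * t - 2 * t"
      by (simp_all add: algebra_simps)
    then show ?thesis by (simp only: cos_add cos_diff) simp
  qed
  show ?thesis
  proof (rule eq_matI)
    fix n k assume "n < dim_row (?G * ?C)" "k < dim_col (?G * ?C)"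
    then have nk: "n < M" "k < M" using G C by auto
    \<comment> \<open>\<open>g\<close> and \<open>h\<close> are the cosine at \<open>k - 1\<close>
      and \<open>k + 1\<close>, with real arguments so that they make sense beyond both
      ends.\<close>
    define f where "f k = w n * cos ((2 * real k + 1) * x n)" for k
    define g where "g = w n * cos ((2 * real k - 1) * x n)"
    define h where "h = w n * cos ((2 * real k + 3) * x n)"
    have gh: "g + h = 2 * cos (2 * x n) * f k"
      using step[of k "x n"] by (simp add: g_def h_def f_def algebra_simps flip: distrib_left)
    have Cf: "?C $$ (n, j) = f j" if "j < M" for j using nk that by (simp add: cos_mat_def f_def)
    have prev: "g = (if k = 0 then f 0 else f (k - 1))"
      by (auto simp: g_def f_def of_nat_diff algebra_simps)
    have "h = s * f k" if "Suc k = M"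
    proof -
      have "real M = real k + 1" using that by linarith
      then show ?thesis using bdry[OF nk(1)] by (simp add: h_def f_def algebra_simps)
    qed
    then have nxt: "h = (if Suc k = M then s * f k else f (Suc k))"
      by (auto simp: h_def f_def algebra_simps)
    have "(?C * ?K) $$ (n, k) = (\<Sum>j<M. ?K\<^sup>T $$ (k, j) * f j)"
      using nk C
      by (auto simp: scalar_prod_def lessThan_atLeast0 Cf mult.commute intro!: sum.cong)
    also have "\<dots> = (1 + \<rho>\<^sup>2 - (if k = 0 then \<rho>\<^sup>2 else 0) - (if Suc k = M then s * \<rho> else 0)) * f k
        - \<rho> * ((if k = 0 then 0 else f (k - 1)) + (if Suc k < M then f (Suc k) else 0))"
      unfolding ar1_tridiag_transpose by (simp add: ar1_tridiag_def tridiag_row_sum[OF nk(2)])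
    \<comment> \<open>The last corner is absorbed exactly by \<open>h = s * f k\<close>. At the
      first corner, completing with \<open>g = f 0\<close> costs \<open>\<rho> * f 0\<close> while
      the entry supplies \<open>\<rho>\<^sup>2 * f 0\<close>; the difference is the rank-one
      term.\<close>
    also have "\<dots> = (1 + \<rho>\<^sup>2) * f k - \<rho> * (g + h) + (if k = 0 then \<rho> * (1 - \<rho>) * f 0 else 0)"
      using nk by (auto simp: prev nxt algebra_simps power2_eq_square)
    also have "\<dots> = (\<rho> * ?l n + (1 - \<rho>)\<^sup>2) * f k + \<rho> * (1 - \<rho>) * f 0 * (if k = 0 then 1 else 0)"
      unfolding gh by (simp add: algebra_simps power2_eq_square)
    also have "\<dots> = (\<Sum>j<M. ?G $$ (n, j) * ?C $$ (j, k))"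
      unfolding diag_plus_rank_one_row_sum[OF q nk(1)] col[OF nk(2)] qn[OF nk(1)] Cf[OF nk(2)] Cf[OF M] ..
    also have "\<dots> = (?G * ?C) $$ (n, k)"
      using nk G C by (simp add: scalar_prod_def lessThan_atLeast0)
    finally show "(?C * ?K) $$ (n, k) = (?G * ?C) $$ (n, k)" .
  qed (use G C in auto)
qed

lemma G_sym_eq:
  "G_sym M \<rho> = diag_plus_rank_one M \<rho> (\<lambda>n. 2 - 2 * cos (real n * pi / real M)) (q_sym M)"
  by (simp add: G_sym_def diag_plus_rank_one_def Lambda2_def)

lemma G_anti_eq:
  "G_anti M \<rho> = diag_plus_rank_one M \<rho> (\<lambda>n. 2 - 2 * cos ((2 * real n + 1) * pi / (2 * real M))) (q_anti M)"
  by (simp add: G_anti_def diag_plus_rank_one_def Lambda4_def)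

lemma dct_carrier[simp]: "dct2 M \<in> carrier_mat M M" "dct4 M \<in> carrier_mat M M"
  by (simp_all add: dct2_def dct4_def)

lemma q_carrier[simp]: "q_sym M \<in> carrier_vec M" "q_anti M \<in> carrier_vec M"
  unfolding q_sym_def q_anti_def by (rule mult_mat_vec_carrier[of _ M M], simp_all)+

lemma dct2_mult_ar1_tridiag:
  assumes M: "0 < M"
  shows "dct2 M * ar1_tridiag M \<rho> \<rho> = G_sym M \<rho> * dct2 M"
proof -
  let ?x = "\<lambda>n. pi * real_of_int (2 * int n) / (4 * real M)"
  have bdry: "cos ((2 * real M + 1) * ?x n) = 1 * cos ((2 * real M - 1) * ?x n)" for n
  proof -
    \<comment> \<open>The cosine is even about multiples of \<open>pi\<close>: the Neumann
      condition.\<close>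
    have "2 * real M * ?x n = real_of_int (int n) * pi" using M by (simp add: field_simps)
    then have "sin (2 * real M * ?x n) = 0" using sin_zero_iff_int2 by blast
    then show ?thesis unfolding distrib_right left_diff_distrib cos_add cos_diff by simp
  qed
  have "2 * ?x n = real n * pi / real M" for n using M by (simp add: field_simps)
  then have "G_sym M \<rho> = diag_plus_rank_one M \<rho> (\<lambda>n. 2 - 2 * cos (2 * ?x n)) (dct2 M *\<^sub>v unit_vec M 0)"
    by (simp only: G_sym_eq q_sym_def)
  then show ?thesis
    using cos_mat_mult_ar1_tridiag[OF M dct2_orthonormal[OF M, unfolded dct2_eq_cos_mat] bdry, of \<rho>]
    by (simp only: dct2_eq_cos_mat mult_1)
qed

lemma dct4_mult_ar1_tridiag:
  assumes M: "0 < M"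
  shows "dct4 M * ar1_tridiag M \<rho> (- \<rho>) = G_anti M \<rho> * dct4 M"
proof -
  let ?x = "\<lambda>n. pi * real_of_int (2 * int n + 1) / (4 * real M)"
  have bdry: "cos ((2 * real M + 1) * ?x n) = - 1 * cos ((2 * real M - 1) * ?x n)" for n
  proof -
    \<comment> \<open>The cosine is odd about its zeros: the Dirichlet condition.\<close>
    have "2 * real M * ?x n = real n * pi + pi / 2" using M by (simp add: field_simps)
    then have "cos (2 * real M * ?x n) = 0" by (simp add: cos_add)
    then show ?thesis unfolding distrib_right left_diff_distrib cos_add cos_diff by simp
  qed
  have "2 * ?x n = (2 * real n + 1) * pi / (2 * real M)" for n using M by (simp add: field_simps)
  then have "G_anti M \<rho> = diag_plus_rank_one M \<rho> (\<lambda>n. 2 - 2 * cos (2 * ?x n)) (dct4 M *\<^sub>v unit_vec M 0)"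
    by (simp only: G_anti_eq q_anti_def)
  then show ?thesis
    using cos_mat_mult_ar1_tridiag[OF M dct4_orthonormal[OF M, unfolded dct4_eq_cos_mat] bdry, of \<rho>]
    by (simp only: dct4_eq_cos_mat mult_minus1)
qed

section \<open>The butterfly and reflection symmetry\<close>

lemma butterfly_carrier[simp]: "butterfly (2 * M) \<in> carrier_mat (2 * M) (2 * M)"
  by (simp add: butterfly_def Let_def mult_2 reversal_mat_def)

lemma butterfly_dim[simp]: "dim_row (butterfly (2 * M)) = 2 * M" "dim_col (butterfly (2 * M)) = 2 * M"
  using carrier_matD[OF butterfly_carrier[of M]] by simp_all

lemma butterfly_index:
  assumes "i < M" "k < 2 * M"
  shows "butterfly (2 * M) $$ (i, k) = (if k = i then 1 / sqrt 2 else 0) + (if k = 2 * M - 1 - i then 1 / sqrt 2 else 0)"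
    and "butterfly (2 * M) $$ (M + i, k) = (if k = i then 1 / sqrt 2 else 0) - (if k = 2 * M - 1 - i then 1 / sqrt 2 else 0)"
  using assms by (auto simp: butterfly_def Let_def reversal_mat_def)

lemma sum_lessThan_double:
  fixes f :: "nat \<Rightarrow> 'a :: comm_monoid_add"
  shows "(\<Sum>j<2 * M. f j) = (\<Sum>j<M. f j) + (\<Sum>j<M. f (M + j))"
proof -
  have "(\<Sum>j<M + K. f j) = (\<Sum>j<M. f j) + (\<Sum>j<K. f (M + j))" for K
    by (induction K) (simp_all add: add.assoc)
  then show ?thesis by (simp add: mult_2)
qed

lemma butterfly_row_sum:
  assumes i: "i < M"
  shows "(\<Sum>k<2 * M. butterfly (2 * M) $$ (i, k) * f k) = (f i + f (2 * M - 1 - i)) / sqrt 2"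
    and "(\<Sum>k<2 * M. butterfly (2 * M) $$ (M + i, k) * f k) = (f i - f (2 * M - 1 - i)) / sqrt 2"
proof -
  have "(\<Sum>k<2 * M. butterfly (2 * M) $$ (i, k) * f k) =
    (\<Sum>k<2 * M. (if k = i then f i / sqrt 2 else 0) + (if k = 2 * M - 1 - i then f (2 * M - 1 - i) / sqrt 2 else 0))"
    by (rule sum.cong) (auto simp: butterfly_index[OF i] add_divide_distrib)
  then show "(\<Sum>k<2 * M. butterfly (2 * M) $$ (i, k) * f k) = (f i + f (2 * M - 1 - i)) / sqrt 2"
    using i by (simp add: sum.distrib add_divide_distrib)
  have "(\<Sum>k<2 * M. butterfly (2 * M) $$ (M + i, k) * f k) =
    (\<Sum>k<2 * M. (if k = i then f i / sqrt 2 else 0) - (if k = 2 * M - 1 - i then f (2 * M - 1 - i) / sqrt 2 else 0))"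
    by (rule sum.cong) (auto simp: butterfly_index[OF i])
  then show "(\<Sum>k<2 * M. butterfly (2 * M) $$ (M + i, k) * f k) = (f i - f (2 * M - 1 - i)) / sqrt 2"
    using i by (simp add: sum_subtractf diff_divide_distrib)
qed

lemma butterfly_col_sum:
  assumes k: "k < 2 * M"
  shows "(\<Sum>j<M. g j * butterfly (2 * M) $$ (j, k)) = (if k < M then g k else g (2 * M - 1 - k)) / sqrt 2"
    and "(\<Sum>j<M. g j * butterfly (2 * M) $$ (M + j, k)) = (if k < M then g k else - g (2 * M - 1 - k)) / sqrt 2"
proof -
  \<comment> \<open>\<open>k\<close> folded into the first half; within each half of the rows,
    column \<open>k\<close> has its only nonzero entry there.\<close>
  define k' where "k' = (if k < M then k else 2 * M - 1 - k)"
  have k': "k' < M" using k by (auto simp: k'_def)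
  have "(\<Sum>j<M. g j * butterfly (2 * M) $$ (j, k)) = (\<Sum>j<M. if j = k' then g k' / sqrt 2 else 0)"
    using k by (intro sum.cong) (auto simp: butterfly_index k'_def)
  then show "(\<Sum>j<M. g j * butterfly (2 * M) $$ (j, k)) = (if k < M then g k else g (2 * M - 1 - k)) / sqrt 2"
    using k' by (simp add: k'_def)
  have "(\<Sum>j<M. g j * butterfly (2 * M) $$ (M + j, k)) =
      (\<Sum>j<M. if j = k' then (if k < M then g k' else - g k') / sqrt 2 else 0)"
    using k by (intro sum.cong) (auto simp: butterfly_index k'_def)
  then show "(\<Sum>j<M. g j * butterfly (2 * M) $$ (M + j, k)) = (if k < M then g k else - g (2 * M - 1 - k)) / sqrt 2"
    using k' by (simp add: k'_def)
qed

lemma less_double_cases: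
  assumes "i < 2 * (M :: nat)"
  obtains "i < M" | i' where "i = M + i'" "i' < M"
proof (cases "i < M")
  case False
  then show thesis using that(2)[of "i - M"] assms by simp
qed (rule that(1))

lemma butterfly_orthonormal: "butterfly (2 * M) * (butterfly (2 * M))\<^sup>T = 1\<^sub>m (2 * M)"
proof (rule eq_matI)
  fix i j assume "i < dim_row (1\<^sub>m (2 * M) :: real mat)" "j < dim_col (1\<^sub>m (2 * M) :: real mat)"
  then have ij: "i < 2 * M" "j < 2 * M" by auto
  let ?B = "butterfly (2 * M)"
  have "(?B * ?B\<^sup>T) $$ (i, j) = (\<Sum>k<2 * M. ?B $$ (i, k) * ?B $$ (j, k))"
    using ij by (simp add: scalar_prod_def lessThan_atLeast0)
  also have "\<dots> = 1\<^sub>m (2 * M) $$ (i, j)"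
    using ij(1)
  proof (cases rule: less_double_cases)
    case 1
    show ?thesis
      unfolding butterfly_row_sum(1)[OF 1] using ij(2)
      by (cases rule: less_double_cases) (use 1 ij in \<open>auto simp: butterfly_index add_divide_distrib real_div_sqrt\<close>)
  next
    case (2 i')
    show ?thesis
      unfolding 2(1) butterfly_row_sum(2)[OF 2(2)] using ij(2)
      by (cases rule: less_double_cases) (use 2 ij in \<open>auto simp: butterfly_index diff_divide_distrib real_div_sqrt\<close>)
  qed
  finally show "(?B * ?B\<^sup>T) $$ (i, j) = 1\<^sub>m (2 * M) $$ (i, j)" .
qed simp_all

text \<open>The quadrants of the matrix with the second half read backwards. The halves interact
  only through the coupling between \<open>M - 1\<close> and \<open>M\<close>, which folding moves
  to the last corner: adding it gives \<open>b = \<rho>\<close>, subtracting it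
  \<open>b = - \<rho>\<close>.\<close>

lemma ar1_tridiag_double_index:
  fixes \<rho> :: real
  assumes ik: "i < M" "k < M"
  defines "T \<equiv> ar1_tridiag (2 * M) \<rho> (\<rho>\<^sup>2)"
  shows "T $$ (i, k) = ar1_tridiag M \<rho> 0 $$ (i, k)"
    and "T $$ (2 * M - 1 - i, k) = (if Suc i = M \<and> Suc k = M then - \<rho> else 0)"
    and "T $$ (i, 2 * M - 1 - k) = (if Suc i = M \<and> Suc k = M then - \<rho> else 0)"
    and "T $$ (2 * M - 1 - i, 2 * M - 1 - k) = ar1_tridiag M \<rho> 0 $$ (i, k)"
proof -
  have "2 * M - 1 - i \<noteq> k" "Suc (2 * M - 1 - i) \<noteq> k" "i \<noteq> 2 * M - 1 - k" "Suc (2 * M - 1 - k) \<noteq> i"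
    "Suc k = 2 * M - 1 - i \<longleftrightarrow> Suc i = M \<and> Suc k = M"
    "Suc i = 2 * M - 1 - k \<longleftrightarrow> Suc i = M \<and> Suc k = M"
    "2 * M - 1 - i = 2 * M - 1 - k \<longleftrightarrow> i = k"
    "Suc (2 * M - 1 - i) = 2 * M - 1 - k \<longleftrightarrow> Suc k = i"
    "Suc (2 * M - 1 - k) = 2 * M - 1 - i \<longleftrightarrow> Suc i = k"
    "Suc (2 * M - 1 - i) = 2 * M \<longleftrightarrow> i = 0" "2 * M - 1 - i \<noteq> 0" "Suc i \<noteq> 2 * M"
    "2 * M - 1 - i < 2 * M" "2 * M - 1 - k < 2 * M" "i < 2 * M" "k < 2 * M"
    using ik by linarith+
  note facts = this ik
  show "T $$ (i, k) = ar1_tridiag M \<rho> 0 $$ (i, k)"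
    "T $$ (2 * M - 1 - i, k) = (if Suc i = M \<and> Suc k = M then - \<rho> else 0)"
    "T $$ (i, 2 * M - 1 - k) = (if Suc i = M \<and> Suc k = M then - \<rho> else 0)"
    "T $$ (2 * M - 1 - i, 2 * M - 1 - k) = ar1_tridiag M \<rho> 0 $$ (i, k)"
    unfolding T_def ar1_tridiag_def tridiag_def
    by (simp_all only: index_mat facts prod.case if_True if_False simp_thms disj_commute) simp_all
qed

text \<open>Reflection symmetry of the precision matrix splits it into its restrictions to symmetric and
  antisymmetric vectors.\<close>

lemma butterfly_mult_ar1_tridiag:
  "butterfly (2 * M) * ar1_tridiag (2 * M) \<rho> (\<rho>\<^sup>2) =
   four_block_mat (ar1_tridiag M \<rho> \<rho>) (0\<^sub>m M M) (0\<^sub>m M M) (ar1_tridiag M \<rho> (- \<rho>)) * butterfly (2 * M)"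
  (is "?B * ?T = ?F * ?B")
proof (rule eq_matI)
  fix i k assume "i < dim_row (?F * ?B)" "k < dim_col (?F * ?B)"
  then have ik: "i < 2 * M" "k < 2 * M" by auto
  have lhs: "(?B * ?T) $$ (i, k) = (\<Sum>j<2 * M. ?B $$ (i, j) * ?T $$ (j, k))"
    using ik by (simp add: scalar_prod_def lessThan_atLeast0)
  have "(?F * ?B) $$ (i, k) = (\<Sum>j<2 * M. ?F $$ (i, j) * ?B $$ (j, k))"
    using ik by (simp add: scalar_prod_def lessThan_atLeast0 del: index_mat_four_block(1))
  then have rhs: "(?F * ?B) $$ (i, k) =
      (\<Sum>j<M. ?F $$ (i, j) * ?B $$ (j, k)) + (\<Sum>j<M. ?F $$ (i, M + j) * ?B $$ (M + j, k))"
    by (simp only: sum_lessThan_double)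
  show "(?B * ?T) $$ (i, k) = (?F * ?B) $$ (i, k)"
    using ik(1)
  proof (cases rule: less_double_cases)
    case 1
    let ?K = "ar1_tridiag M \<rho> \<rho>"
    have "(?F * ?B) $$ (i, k) = (\<Sum>j<M. ?K $$ (i, j) * ?B $$ (j, k))"
      unfolding rhs using 1 by simp
    also have "\<dots> = (if k < M then ?K $$ (i, k) else ?K $$ (i, 2 * M - 1 - k)) / sqrt 2"
      by (rule butterfly_col_sum(1)[OF ik(2)])
    also have "(if k < M then ?K $$ (i, k) else ?K $$ (i, 2 * M - 1 - k)) =
        ?T $$ (i, k) + ?T $$ (2 * M - 1 - i, k)"
    proof (cases "k < M")
      case True
      then show ?thesis unfolding ar1_tridiag_double_index[OF 1 True]
        using 1 by (auto simp: ar1_tridiag_def tridiag_def)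
    next
      case False
      define l where "l = 2 * M - 1 - k"
      have l: "l < M" "k = 2 * M - 1 - l" "\<not> 2 * M - 1 - l < M" "2 * M - 1 - (2 * M - 1 - l) = l"
        using False ik by (auto simp: l_def)
      show ?thesis unfolding l(2) l(4) ar1_tridiag_double_index[OF 1 l(1)]
        using l(1,3) 1 by (auto simp: ar1_tridiag_def tridiag_def)
    qed
    also have "(?T $$ (i, k) + ?T $$ (2 * M - 1 - i, k)) / sqrt 2 = (?B * ?T) $$ (i, k)"
      unfolding lhs by (rule butterfly_row_sum(1)[OF 1, symmetric])
    finally show ?thesis ..
  next
    case (2 i')
    let ?K = "ar1_tridiag M \<rho> (- \<rho>)"
    have "(?F * ?B) $$ (i, k) = (\<Sum>j<M. ?K $$ (i', j) * ?B $$ (M + j, k))"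
      unfolding rhs using 2 by simp
    also have "\<dots> = (if k < M then ?K $$ (i', k) else - ?K $$ (i', 2 * M - 1 - k)) / sqrt 2"
      by (rule butterfly_col_sum(2)[OF ik(2)])
    also have "(if k < M then ?K $$ (i', k) else - ?K $$ (i', 2 * M - 1 - k)) =
        ?T $$ (i', k) - ?T $$ (2 * M - 1 - i', k)"
    proof (cases "k < M")
      case True
      then show ?thesis unfolding ar1_tridiag_double_index[OF 2(2) True]
        using 2 by (auto simp: ar1_tridiag_def tridiag_def)
    next
      case False
      define l where "l = 2 * M - 1 - k"
      have l: "l < M" "k = 2 * M - 1 - l" "\<not> 2 * M - 1 - l < M" "2 * M - 1 - (2 * M - 1 - l) = l"
        using False ik by (auto simp: l_def)
      show ?thesis unfolding l(2) l(4) ar1_tridiag_double_index[OF 2(2) l(1)]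
        using l(1,3) 2 by (auto simp: ar1_tridiag_def tridiag_def)
    qed
    also have "(?T $$ (i', k) - ?T $$ (2 * M - 1 - i', k)) / sqrt 2 = (?B * ?T) $$ (i, k)"
      unfolding lhs unfolding 2(1) by (rule butterfly_row_sum(2)[OF 2(2), symmetric])
    finally show ?thesis ..
  qed
qed simp_all

section \<open>The interleaving permutation\<close>

lemma interleave_carrier[simp]: "interleave_mat (2 * M) \<in> carrier_mat (2 * M) (2 * M)"
  by (simp add: interleave_mat_def)

lemma interleave_index:
  assumes "r < 2 * M" "c < 2 * M"
  shows "interleave_mat (2 * M) $$ (r, c) = (if c = (if even r then r div 2 else M + r div 2) then 1 else 0)"
proof -
  have "(\<exists>i<M. (r = 2 * i \<and> c = i) \<or> (r = 2 * i + 1 \<and> c = M + i)) \<longleftrightarrow>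
      c = (if even r then r div 2 else M + r div 2)"
  proof (cases "even r")
    case True
    then obtain b where b: "r = 2 * b" by blast
    have "2 * b \<noteq> 2 * i + 1" for i by presburger
    then show ?thesis using assms b by auto
  next
    case False
    then obtain b where b: "r = 2 * b + 1" by (rule oddE)
    have "2 * b + 1 \<noteq> 2 * i" for i by presburger
    then show ?thesis using assms b by auto
  qed
  then show ?thesis using assms by (simp add: interleave_mat_def)
qed

text \<open>Replaces the permutation matrix by an index map on rows, the form that
  \<open>orthonormal_eigenrows_permute\<close> expects.\<close>

lemma row_interleave_mult:
  assumes X: "X \<in> carrier_mat (2 * M) n" and r: "r < 2 * M"
  shows "row (interleave_mat (2 * M) * X) r = row X (if even r then r div 2 else M + r div 2)"
proof -
  let ?s = "if even r then r div 2 else M + r div 2"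
  have s: "?s < 2 * M" using r by auto
  have dim: "dim_row (interleave_mat (2 * M)) = 2 * M" "dim_col (interleave_mat (2 * M)) = 2 * M"
    by (simp_all add: interleave_mat_def)
  show ?thesis
  proof (rule eq_vecI)
    fix j assume "j < dim_vec (row X ?s)"
    then have j: "j < n" using X by simp
    have "row (interleave_mat (2 * M) * X) r $ j = (\<Sum>c<2 * M. interleave_mat (2 * M) $$ (r, c) * X $$ (c, j))"
      using X r j by (simp add: scalar_prod_def lessThan_atLeast0 dim)
    also have "\<dots> = (\<Sum>c<2 * M. if c = ?s then X $$ (?s, j) else 0)"
      by (rule sum.cong) (auto simp: interleave_index[OF r])
    also have "\<dots> = X $$ (?s, j)"
      using s by simp
    finally show "row (interleave_mat (2 * M) * X) r $ j = row X ?s $ j"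
      using X s j by simp
  qed (use X in simp)
qed

section \<open>Assembly of the factorization\<close>

theorem theorem4p3:
  fixes \<rho> :: real and N M :: nat and Qs Qa :: "real mat"
  assumes "0 < \<rho>" and "\<rho> < 1"
    and "N \<ge> 2" and "even N" and "M = N div 2"
    and "increasing_eigenrows (G_sym M \<rho>) Qs"
    and "increasing_eigenrows (G_anti M \<rho>) Qa"
  shows "is_klt N \<rho>
           (interleave_mat N *
            four_block_mat (Qs * dct2 M) (0\<^sub>m M M) (0\<^sub>m M M) (Qa * dct4 M) *
            butterfly N)
       \<and> (\<forall>W. is_klt N \<rho> W \<longrightarrow>
            eq_up_to_row_signs W
              (interleave_mat N *
               four_block_mat (Qs * dct2 M) (0\<^sub>m M M) (0\<^sub>m M M) (Qa * dct4 M) *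
               butterfly N))"
proof -
  note \<rho> = assms(1,2)
  have N: "N = 2 * M" and M: "0 < M" using assms(3-5) by auto
  let ?Ks = "ar1_tridiag M \<rho> \<rho>" and ?Ka = "ar1_tridiag M \<rho> (- \<rho>)" and ?T = "ar1_tridiag N \<rho> (\<rho>\<^sup>2)"
  let ?U = "four_block_mat (Qs * dct2 M) (0\<^sub>m M M) (0\<^sub>m M M) (Qa * dct4 M)"
  let ?V = "interleave_mat N * ?U * butterfly N"
  have Gs: "G_sym M \<rho> \<in> carrier_mat M M" "(G_sym M \<rho>)\<^sup>T = G_sym M \<rho>"
    and Ga: "G_anti M \<rho> \<in> carrier_mat M M" "(G_anti M \<rho>)\<^sup>T = G_anti M \<rho>"
    by (simp_all add: G_sym_eq G_anti_eq diag_plus_rank_one_carrier diag_plus_rank_one_transpose)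
  obtain a where a: "orthonormal_eigenrows (G_sym M \<rho>) Qs a"
    and a_mono: "\<And>i j. i \<le> j \<Longrightarrow> j < M \<Longrightarrow> a i \<le> a j"
    using assms(6) Gs by (auto simp: increasing_eigenrows_def)
  obtain b where b: "orthonormal_eigenrows (G_anti M \<rho>) Qa b"
    and b_mono: "\<And>i j. i \<le> j \<Longrightarrow> j < M \<Longrightarrow> b i \<le> b j"
    using assms(7) Ga by (auto simp: increasing_eigenrows_def)
  have a_pos: "0 < a i" if "i < M" for i
    by (rule diag_plus_rank_one_eigenvalues_pos[OF \<rho> _ _ a[unfolded G_sym_eq] that]) auto
  have b_pos: "0 < b i" if "i < M" for i
    by (rule diag_plus_rank_one_eigenvalues_pos[OF \<rho> _ _ b[unfolded G_anti_eq] that]) auto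
  have Us: "orthonormal_eigenrows ?Ks (Qs * dct2 M) a"
    by (rule orthonormal_eigenrows_conj[OF Gs _ _ a _ dct2_orthonormal[OF M] dct2_mult_ar1_tridiag[OF M]])
      (simp_all add: ar1_tridiag_transpose)
  have Ua: "orthonormal_eigenrows ?Ka (Qa * dct4 M) b"
    by (rule orthonormal_eigenrows_conj[OF Ga _ _ b _ dct4_orthonormal[OF M] dct4_mult_ar1_tridiag[OF M]])
      (simp_all add: ar1_tridiag_transpose)
  have form: "x \<bullet> (?Ka *\<^sub>v x) = x \<bullet> (?Ks *\<^sub>v x) + 2 * \<rho> * (unit_vec M (M - 1) \<bullet> x)\<^sup>2"
    if "x \<in> carrier_vec M" for x
    using ar1_tridiag_rank_one[OF M that, of \<rho> "- \<rho>" \<rho>] by simp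
  note interlace = rank_one_interlacing[OF ar1_tridiag_carrier ar1_tridiag_transpose
      ar1_tridiag_carrier ar1_tridiag_transpose Us Ua a_mono b_mono unit_vec_carrier _ form]
  have ab: "a i \<le> b i" if "i < M" for i
    using interlace(1) that \<rho> by simp
  have ba: "b i \<le> a (Suc i)" if "Suc i < M" for i
    using interlace(2) that \<rho> by simp

  define s where "s r = (if even r then r div 2 else M + r div 2)" for r
  \<comment> \<open>\<open>d\<close> lists the eigenvalues block by block, \<open>e\<close> in the
    interleaved order \<open>a 0\<close>, \<open>b 0\<close>, \<open>a 1\<close>, \<open>b 1\<close>
    and so on.\<close>
  define d where "d i = (if i < M then a i else b (i - M))" for i
  define e where "e r = d (s r)" for r
  have s_less: "s r < N" if "r < N" for r using that N by (auto simp: s_def)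
  have s_inj: "inj_on s {..<N}"
  proof (rule inj_onI)
    fix r t assume "r \<in> {..<N}" "t \<in> {..<N}" "s r = s t"
    \<comment> \<open>Even positions land below \<open>M\<close> and odd ones at or above it, so the
      value of \<open>s\<close> reveals the parity.\<close>
    moreover have "r div 2 < M" "t div 2 < M" using calculation N by auto
    ultimately show "r = t"
      by (auto simp: s_def split: if_splits elim!: evenE oddE)
  qed
  let ?F = "four_block_mat ?Ks (0\<^sub>m M M) (0\<^sub>m M M) ?Ka"
  have F: "?F \<in> carrier_mat N N" unfolding N mult_2 by simp
  have Ft: "?F\<^sup>T = ?F"
    by (simp add: four_block_diag_transpose[of _ M _ M] ar1_tridiag_transpose)
  have "orthonormal_eigenrows ?F ?U d"
    unfolding d_def
    by (rule orthonormal_eigenrows_four_block_diag[OF ar1_tridiag_carrier ar1_tridiag_transpose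
          ar1_tridiag_carrier ar1_tridiag_transpose Us Ua])
  then have UB: "orthonormal_eigenrows ?T (?U * butterfly N) d"
    unfolding N
    by (intro orthonormal_eigenrows_conj[OF F[unfolded N] Ft ar1_tridiag_carrier ar1_tridiag_transpose
          _ butterfly_carrier butterfly_orthonormal butterfly_mult_ar1_tridiag])
  have Uc: "?U \<in> carrier_mat N N" and UBc: "?U * butterfly N \<in> carrier_mat N N"
    using \<open>orthonormal_eigenrows ?F ?U d\<close> UB F by (auto simp: orthonormal_eigenrows_def)
  have assoc: "?V = interleave_mat N * (?U * butterfly N)"
    unfolding N by (rule assoc_mult_mat[OF interleave_carrier Uc[unfolded N] butterfly_carrier])
  have V: "orthonormal_eigenrows ?T ?V e"
    unfolding e_def
  proof (rule orthonormal_eigenrows_permute[OF ar1_tridiag_carrier UB _ s_less s_inj])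
    show "?V \<in> carrier_mat N N" 
      unfolding assoc unfolding N by (rule mult_carrier_mat[OF interleave_carrier UBc[unfolded N]])
    show "row ?V r = row (?U * butterfly N) (s r)" if "r < N" for r
      unfolding assoc s_def using row_interleave_mult[OF UBc[unfolded N]] that N by simp
  qed
  have e_eq: "e r = (if even r then a (r div 2) else b (r div 2))" if "r < N" for r
    using that N by (auto simp: e_def d_def s_def)
  have e_pos: "0 < e r" if "r < N" for r
    using that N a_pos[of "r div 2"] b_pos[of "r div 2"] by (auto simp: e_eq)
  \<comment> \<open>The two interlacing inequalities alternate: \<open>ab\<close> at even positions,
    \<open>ba\<close> at odd ones.\<close>
  have e_Suc: "e r \<le> e (Suc r)" if "Suc r < N" for r
    using that N ab[of "r div 2"] ba[of "r div 2"] by (cases "even r") (auto simp: e_eq elim!: evenE oddE)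
  have e_strict: "e i < e j" if "i < j" "j < N" for i j
  proof -
    have "e i \<le> e j" using \<open>i < j\<close>[THEN less_imp_le] \<open>j < N\<close>
    proof (induction j rule: dec_induct)
      case (step j)
      then show ?case using e_Suc[of j] by simp
    qed simp
    \<comment> \<open>Simplicity is applied to the full tridiagonal matrix, which also separates
      eigenvalues of different blocks.\<close>
    moreover have "e i \<noteq> e j"
      using tridiag_eigenvalues_distinct[OF _ V[unfolded ar1_tridiag_def]] that \<rho> by auto
    ultimately show ?thesis by simp
  qed
  let ?f = "\<lambda>r. (1 - \<rho>\<^sup>2) / e r"
  have c: "0 < 1 - \<rho>\<^sup>2" using \<rho> by (simp add: power_less_one_iff)
  have R: "orthonormal_eigenrows (ar1_cov N \<rho>) ?V ?f"
    by (rule orthonormal_eigenrows_inverse[OF ar1_tridiag_carrier ar1_tridiag_transpose ar1_cov_carrier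
          ar1_cov_transpose ar1_tridiag_mult_cov[OF assms(3)] V])
      (use e_pos in force)
  have f_strict: "?f j < ?f i" if "i < j" "j < N" for i j
    using e_strict[OF that] e_pos[of i] e_pos[of j] that c by (intro divide_strict_left_mono) auto
  have dimR: "dim_row (ar1_cov N \<rho>) = N" by (simp add: ar1_cov_def)
  have "is_klt N \<rho> ?V"
    unfolding is_klt_def decreasing_eigenrows_def dimR
    using R f_strict by (intro exI[of _ ?f]) (auto simp: le_less)
  moreover have "eq_up_to_row_signs W ?V" if "is_klt N \<rho> W" for W
  proof -
    obtain g where W: "orthonormal_eigenrows (ar1_cov N \<rho>) W g"
      and g: "\<And>i j. i \<le> j \<Longrightarrow> j < N \<Longrightarrow> g j \<le> g i"
      using \<open>is_klt N \<rho> W\<close> unfolding is_klt_def decreasing_eigenrows_def dimR by blast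
    show ?thesis
      by (rule eigenrows_unique_up_to_signs[OF ar1_cov_carrier ar1_cov_transpose R W f_strict g])
  qed
  ultimately show ?thesis by blast
qed

end
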